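(* Let $p,d\geq 1$ be integers and let $a_{ij},b_{ij}\in\mathbb{R}\cup\{-\infty\}$ for $1\leq i\leq p$, $1\leq j\leq d$. Let $\mathcal{C}\subseteq(\mathbb{R}\cup\{-\infty\})^d$ be the tropical cone \[ \mathcal{C}=\Big\{x\in(\mathbb{R}\cup\{-\infty\})^d \;:\; \max_{1\leq j\leq d}(a_{ij}+x_j)\leq \max_{1\leq j\leq d}(b_{ij}+x_j)\ \text{ for all }1\leq i\leq p\Big\}, \] i.e. the intersection of $p$ tropical half-spaces. Then the number of extreme rays of $\mathcal{C}$ is at most $U(p+d,d-1)$.
   Context: The max-plus semiring $\mathbb{R}_{\max}=\mathbb{R}\cup\{-\infty\}$ has addition $a\oplus b=\max(a,b)$ and multiplication $a\otimes b=a+b$ (with $-\infty$ absorbing for $+$). For vectors, $u\oplus v$ is the entrywise maximum and $\lambda u$ (for $\lambda\in\mathbb{R}_{\max}$) is the vector $(\lambda+u_j)_j$. A tropical cone is a set $\mathcal{C}\subseteq\mathbb{R}_{\max}^d$ such that $u,v\in\mathcal{C}$, $\lambda,\mu\in\mathbb{R}_{\max}$ imply $\lambda u\oplus\mu v\in\mathcal{C}$. A vector $u\in\mathcal{C}$ other than the all-$(-\infty)$ vector is an extreme generator if $u=v\oplus w$ with $v,w\in\mathcal{C}$ implies $u=v$ or $u=w$; the set $\{\lambda u:\lambda\in\mathbb{R}_{\max}\}$ of tropical scalar multiples of an extreme generator $u$ is an extreme ray. For integers $n\geq 0$, $m\geq 0$, with binomial coefficients $\binom{a}{b}=0$ when $b<0$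 or $b>a$, define $U(n,m)=\binom{n-\lfloor m/2\rfloor}{\lfloor m/2\rfloor}+\binom{n-\lfloor m/2\rfloor-1}{\lfloor m/2\rfloor-1}$ if $m$ is even and $U(n,m)=2\binom{n-\lfloor m/2\rfloor-1}{\lfloor m/2\rfloor}$ if $m$ is odd (McMullen's upper bound for the number of facets of a polytope of dimension $m$ with $n$ vertices). *)

theory Defs
  imports "HOL-Analysis.Analysis"
begin

(* R_max is the set of extended reals other than \<infinity>. On it, + of ereal is the max-plus product:
   -\<infinity> is absorbing (the convention -\<infinity> + \<infinity> = \<infinity> of ereal never comes into play). *)
definition Rmax :: "ereal set"
  where "Rmax = {x. x \<noteq> \<infinity>}"

definition Rmax_vec :: "(ereal ^ 'd) set"
  where "Rmax_vec = {x. \<forall>j. x $ j \<in> Rmax}"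

definition trop_add :: "ereal ^ 'd \<Rightarrow> ereal ^ 'd \<Rightarrow> ereal ^ 'd"
  where "trop_add u v = (\<chi> j. max (u $ j) (v $ j))"

definition trop_scale :: "ereal \<Rightarrow> ereal ^ 'd \<Rightarrow> ereal ^ 'd"
  where "trop_scale c u = (\<chi> j. c + u $ j)"

definition trop_cone :: "(ereal ^ 'd) set \<Rightarrow> bool"
  where "trop_cone C \<longleftrightarrow> C \<subseteq> Rmax_vec \<and>
    (\<forall>u\<in>C. \<forall>v\<in>C. \<forall>c\<in>Rmax. \<forall>e\<in>Rmax. trop_add (trop_scale c u) (trop_scale e v) \<in> C)"

definition extreme_generator :: "(ereal ^ 'd) set \<Rightarrow> ereal ^ 'd \<Rightarrow> bool"
  where "extreme_generator C u \<longleftrightarrow> u \<in> C \<and> u \<noteq> (\<chi> j. -\<infinity>) \<and>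
    (\<forall>v\<in>C. \<forall>w\<in>C. u = trop_add v w \<longrightarrow> u = v \<or> u = w)"

definition trop_ray :: "ereal ^ 'd \<Rightarrow> (ereal ^ 'd) set"
  where "trop_ray u = (\<lambda>c. trop_scale c u) ` Rmax"

definition extreme_rays :: "(ereal ^ 'd) set \<Rightarrow> (ereal ^ 'd) set set"
  where "extreme_rays C = trop_ray ` {u. extreme_generator C u}"

definition trop_system_cone :: "ereal ^ 'd ^ 'p \<Rightarrow> ereal ^ 'd ^ 'p \<Rightarrow> (ereal ^ 'd) set"
  where "trop_system_cone A B =
    {x \<in> Rmax_vec. \<forall>i. (MAX j. A $ i $ j + x $ j) \<le> (MAX j. B $ i $ j + x $ j)}"

lemma trop_cone_trop_system_cone:
  fixes A B :: "ereal ^ 'd::finite ^ 'p::finite"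
  shows "trop_cone (trop_system_cone A B)"
proof -
  have iff: "(MAX j. f j) \<le> (MAX j. g j) \<longleftrightarrow> (\<forall>j. \<exists>k. f j \<le> g k)"
    for f g :: "'d \<Rightarrow> ereal"
  proof -
    have "(MAX j. f j) \<le> (MAX j. g j) \<longleftrightarrow> (\<forall>j. f j \<le> (MAX j. g j))"
      by (subst Max_le_iff) auto
    also have "\<dots> \<longleftrightarrow> (\<forall>j. \<exists>k. f j \<le> g k)"
      by (subst Max_ge_iff) auto
    finally show ?thesis .
  qed
  have "\<exists>k. A $ i $ j + max (c + u $ j) (e + v $ j) \<le> B $ i $ k + max (c + u $ k) (e + v $ k)"
    if u: "\<forall>i j. \<exists>k. A $ i $ j + u $ j \<le> B $ i $ k + u $ k"
      and v: "\<forall>i j. \<exists>k. A $ i $ j + v $ j \<le> B $ i $ k + v $ k"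
    for u v c e i j
  proof (cases "c + u $ j \<le> e + v $ j")
    case True
    obtain k where "A $ i $ j + v $ j \<le> B $ i $ k + v $ k" using v by blast
    then have "A $ i $ j + (e + v $ j) \<le> B $ i $ k + (e + v $ k)"
      by (metis add.left_commute add_left_mono)
    also have "\<dots> \<le> B $ i $ k + max (c + u $ k) (e + v $ k)"
      by (intro add_left_mono) simp
    finally show ?thesis using True by (metis max.absorb2)
  next
    case False
    obtain k where "A $ i $ j + u $ j \<le> B $ i $ k + u $ k" using u by blast
    then have "A $ i $ j + (c + u $ j) \<le> B $ i $ k + (c + u $ k)"
      by (metis add.left_commute add_left_mono)
    also have "\<dots> \<le> B $ i $ k + max (c + u $ k) (e + v $ k)"
      by (intro add_left_mono) simp
    finally show ?thesis using False by (metis linear max.absorb1)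
  qed
  moreover have "max (c + s) (e + t) \<noteq> \<infinity>"
    if "c \<noteq> \<infinity>" "e \<noteq> \<infinity>" "s \<noteq> \<infinity>" "t \<noteq> \<infinity>" for c e s t :: ereal
    using that by (simp add: max_def)
  ultimately show ?thesis
    by (simp add: trop_cone_def trop_system_cone_def iff trop_add_def trop_scale_def
        Rmax_vec_def Rmax_def subset_iff)
qed

(* Binomial coefficient with integer arguments, 0 unless 0 \<le> b \<le> a. Truncated subtraction on nat
   would give the wrong value for U n 0, whose second summand is a binomial over -1. *)
definition binom :: "int \<Rightarrow> int \<Rightarrow> nat"
  where "binom a b = (if 0 \<le> b \<and> b \<le> a then nat a choose nat b else 0)"

definition U :: "nat \<Rightarrow> nat \<Rightarrow> nat"
  where "U n m = (let h = int (m div 2) in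
    if even m then binom (int n - h) h + binom (int n - h - 1) (h - 1)
    else 2 * binom (int n - h - 1) h)"

end

theory Submission
  imports Defs
begin

text \<open>
  The tropical cone is a limit, under \<open>x \<mapsto> ln x / t\<close> with \<open>t \<rightarrow> \<infinity>\<close>, of classical cones cut out of the
  positive orthant by \<open>p\<close> half-spaces, which may be perturbed into general position. If each of
  them is generated by at most \<open>N\<close> vectors, limits of these vectors generate the tropical cone, so every
  extreme ray is spanned by one of the \<open>N\<close> limits.

  For a classical cone in general position \<open>N\<close> is given by McMullen's upper bound theorem: a generic
  linear objective orients the edges of the simple polytope obtained by slicing the cone, and sending a vertex
  to its descending edges partitions the dual simplicial complex into intervals. The resulting $h$-numbers do
  not depend on the objective. Reversing the objective gives the Dehn--Sommerville symmetry, and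
  objectives minimised on a given facet bound the $h$-numbers of links, which yields McMullen's recursion.
\<close>

section \<open>Partitionable complexes and McMullen's recursion\<close>

text \<open>The intervals \<open>[r S, S]\<close> partition the simplicial complex with facets \<open>V\<close>; \<open>r\<close> is the restriction map
  of a shelling, and \<open>h_number\<close> counts the facets by the size of their restriction.\<close>

definition interval_partition :: "'a set set \<Rightarrow> ('a set \<Rightarrow> 'a set) \<Rightarrow> bool"
  where "interval_partition V r \<longleftrightarrow> (\<forall>S\<in>V. r S \<subseteq> S) \<and>
    (\<forall>S\<in>V. \<forall>R\<subseteq>S. \<exists>!T. T \<in> V \<and> r T \<subseteq> R \<and> R \<subseteq> T)"

definition h_number :: "'a set set \<Rightarrow> ('a set \<Rightarrow> 'a set) \<Rightarrow> nat \<Rightarrow> nat"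
  where "h_number V r k = card {S \<in> V. card (r S) = k}"

lemma interval_partition_ex:
  assumes "interval_partition V r" "S \<in> V" "R \<subseteq> S"
  obtains T where "T \<in> V" "r T \<subseteq> R" "R \<subseteq> T"
  using assms unfolding interval_partition_def by meson

lemma interval_partition_unique:
  assumes "interval_partition V r" "S \<in> V" "r S \<subseteq> R" "R \<subseteq> S" "T \<in> V" "r T \<subseteq> R" "R \<subseteq> T"
  shows "S = T"
proof -
  have "\<exists>!T. T \<in> V \<and> r T \<subseteq> R \<and> R \<subseteq> T"
    using assms(1,2,4) by (simp add: interval_partition_def)
  then show ?thesis using assms by blast
qed

lemma interval_partition_cong:
  assumes "\<And>S. S \<in> V \<Longrightarrow> r S = r' S"
  shows "interval_partition V r \<longleftrightarrow> interval_partition V r'"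
  unfolding interval_partition_def using assms by (simp cong: conj_cong ball_cong)

section \<open>Face numbers and h-numbers\<close>

lemma card_subsets_between:
  assumes "finite S" "A \<subseteq> S"
  shows "card {R. A \<subseteq> R \<and> R \<subseteq> S \<and> card R = m} =
    (if card A \<le> m then (card S - card A) choose (m - card A) else 0)"
proof (cases "card A \<le> m")
  case True
  have fin: "finite A" "finite (S - A)" using assms finite_subset by auto
  have "bij_betw (\<lambda>T. A \<union> T) {T. T \<subseteq> S - A \<and> card T = m - card A}
      {R. A \<subseteq> R \<and> R \<subseteq> S \<and> card R = m}"
  proof (rule bij_betw_byWitness[where f' = "\<lambda>R. R - A"])
    show "(\<union>) A ` {T. T \<subseteq> S - A \<and> card T = m - card A} \<subseteq> {R. A \<subseteq> R \<and> R \<subseteq> S \<and> card R = m}"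
    proof (rule image_subsetI)
      fix T assume "T \<in> {T. T \<subseteq> S - A \<and> card T = m - card A}"
      then have T: "T \<subseteq> S - A" "card T = m - card A" by auto
      then have "finite T" "A \<inter> T = {}" using fin finite_subset by auto
      then have "card (A \<union> T) = card A + card T" using fin by (simp add: card_Un_disjoint)
      then show "A \<union> T \<in> {R. A \<subseteq> R \<and> R \<subseteq> S \<and> card R = m}" using T True assms by auto
    qed
    show "(\<lambda>R. R - A) ` {R. A \<subseteq> R \<and> R \<subseteq> S \<and> card R = m} \<subseteq> {T. T \<subseteq> S - A \<and> card T = m - card A}"
      using fin by (auto simp: card_Diff_subset)
  qed auto
  then have "card {R. A \<subseteq> R \<and> R \<subseteq> S \<and> card R = m} = card (S - A) choose (m - card A)"
    by (simp only: bij_betw_same_card[symmetric] n_subsets[OF fin(2)])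
  then show ?thesis using True assms fin by (simp add: card_Diff_subset)
next
  case False
  have "card A \<le> card R" if "A \<subseteq> R" "R \<subseteq> S" for R
    using that assms(1) by (meson card_mono finite_subset)
  then have "{R. A \<subseteq> R \<and> R \<subseteq> S \<and> card R = m} = {}"
    using False by blast
  then have "card {R. A \<subseteq> R \<and> R \<subseteq> S \<and> card R = m} = 0" by (simp only: card.empty)
  then show ?thesis using False by (simp only: if_False)
qed

text \<open>The intervals \<open>[r S, S]\<close> split the faces into disjoint classes, and one
  with \<open>card (r S) = k\<close> holds \<open>(D - k) choose (m - k)\<close> faces of size
  \<open>m\<close>: the usual passage from h-vector to f-vector.\<close>

lemma card_faces:
  assumes "finite V" and V: "\<And>S. S \<in> V \<Longrightarrow> finite S \<and> card S = D" and r: "interval_partition V r"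
  shows "card {R. (\<exists>S\<in>V. R \<subseteq> S) \<and> card R = m} =
    (\<Sum>k\<le>m. h_number V r k * ((D - k) choose (m - k)))"
proof -
  let ?I = "\<lambda>S. {R. r S \<subseteq> R \<and> R \<subseteq> S \<and> card R = m}"
  have rS: "r S \<subseteq> S" if "S \<in> V" for S using r that by (auto simp: interval_partition_def)
  have un: "{R. (\<exists>S\<in>V. R \<subseteq> S) \<and> card R = m} = (\<Union>S\<in>V. ?I S)"
    by (auto elim: interval_partition_ex[OF r])
  have "card (\<Union>S\<in>V. ?I S) = (\<Sum>S\<in>V. card (?I S))"
  proof (rule card_UN_disjoint)
    show "\<forall>S\<in>V. finite (?I S)"
      using V by (auto intro: finite_subset[of _ "Pow S" for S])
    show "\<forall>S\<in>V. \<forall>T\<in>V. S \<noteq> T \<longrightarrow> ?I S \<inter> ?I T = {}"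
      using interval_partition_unique[OF r] by blast
  qed (use assms in auto)
  also have "\<dots> = (\<Sum>S\<in>V. \<Sum>k\<le>m. if card (r S) = k then (D - k) choose (m - k) else 0)"
    using V rS by (intro sum.cong) (auto simp: card_subsets_between)
  also have "\<dots> = (\<Sum>k\<le>m. \<Sum>S\<in>V. if card (r S) = k then (D - k) choose (m - k) else 0)"
    by (rule sum.swap)
  also have "\<dots> = (\<Sum>k\<le>m. h_number V r k * ((D - k) choose (m - k)))"
    using \<open>finite V\<close> by (simp add: h_number_def sum.If_cases Int_def)
  finally show ?thesis using un by simp
qed

text \<open>Face numbers depend on \<open>V\<close> alone, and the system expressing them through
  h-numbers is triangular with unit diagonal.\<close>

lemma h_number_unique:
  assumes "finite V" "\<And>S. S \<in> V \<Longrightarrow> finite S \<and> card S = D"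
    and "interval_partition V r" "interval_partition V r'"
  shows "h_number V r k = h_number V r' k"
proof (induction k rule: less_induct)
  case (less k)
  have "(\<Sum>i\<le>k. h_number V r i * ((D - i) choose (k - i))) =
      (\<Sum>i\<le>k. h_number V r' i * ((D - i) choose (k - i)))"
    using card_faces[OF assms(1,2,3), of k] card_faces[OF assms(1,2,4), of k] by simp
  moreover have "(\<Sum>i<k. h_number V r i * ((D - i) choose (k - i))) =
      (\<Sum>i<k. h_number V r' i * ((D - i) choose (k - i)))"
    using less by (intro sum.cong) auto
  ultimately show ?case by (simp add: lessThan_Suc_atMost[symmetric])
qed

section \<open>Vertex links\<close>

definition link :: "'a set set \<Rightarrow> 'a \<Rightarrow> 'a set set"
  where "link V i = (\<lambda>S. S - {i}) ` {S \<in> V. i \<in> S}"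

text \<open>Faces \<open>R\<close> of the link correspond to faces \<open>insert i R\<close> of the
  complex, whose interval has \<open>i\<close> in its top. Deleting \<open>i\<close> from both ends
  gives the interval of \<open>R\<close>.\<close>

lemma interval_partition_link:
  assumes r: "interval_partition V r"
  shows "interval_partition (link V i) (\<lambda>S. r (insert i S) - {i})"
  unfolding interval_partition_def
proof (intro conjI ballI allI impI)
  fix S assume "S \<in> link V i"
  then obtain S' where S': "S' \<in> V" "i \<in> S'" "S = S' - {i}" by (auto simp: link_def)
  then have ins: "insert i S = S'" by auto
  then show "r (insert i S) - {i} \<subseteq> S"
    using r S' by (auto simp: interval_partition_def)
  fix R assume R: "R \<subseteq> S"
  then have "insert i R \<subseteq> S'" using S' by auto
  then have ex: "\<exists>!T. T \<in> V \<and> r T \<subseteq> insert i R \<and> insert i R \<subseteq> T"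
    using r S' unfolding interval_partition_def by blast
  then obtain T where T: "T \<in> V" "r T \<subseteq> insert i R" "insert i R \<subseteq> T" by blast
  have iR: "i \<notin> R" using R S' by auto
  show "\<exists>!T. T \<in> link V i \<and> r (insert i T) - {i} \<subseteq> R \<and> R \<subseteq> T"
  proof (rule ex1I[of _ "T - {i}"])
    have "insert i (T - {i}) = T" using T by auto
    then show "T - {i} \<in> link V i \<and> r (insert i (T - {i})) - {i} \<subseteq> R \<and> R \<subseteq> T - {i}"
      using T iR by (auto simp: link_def)
  next
    fix T' assume T': "T' \<in> link V i \<and> r (insert i T') - {i} \<subseteq> R \<and> R \<subseteq> T'"
    then obtain T'' where T'': "T'' \<in> V" "i \<in> T''" "T' = T'' - {i}" by (auto simp: link_def)
    then have "insert i T' = T''" by auto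
    then have "r T'' \<subseteq> insert i R" "insert i R \<subseteq> T''" using T' T'' by auto
    then have "T'' = T" using ex T T'' by blast
    then show "T' = T - {i}" using T'' by simp
  qed
qed

lemma h_number_link:
  "h_number (link V i) (\<lambda>S. r (insert i S) - {i}) k = card {S \<in> V. i \<in> S \<and> card (r S - {i}) = k}"
proof -
  have "bij_betw (\<lambda>S. S - {i}) {S \<in> V. i \<in> S \<and> card (r S - {i}) = k}
      {S \<in> link V i. card (r (insert i S) - {i}) = k}"
  proof (rule bij_betw_imageI)
    show "inj_on (\<lambda>S. S - {i}) {S \<in> V. i \<in> S \<and> card (r S - {i}) = k}"
      by (auto simp: inj_on_def)
    show "(\<lambda>S. S - {i}) ` {S \<in> V. i \<in> S \<and> card (r S - {i}) = k} =
        {S \<in> link V i. card (r (insert i S) - {i}) = k}"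
    proof (intro equalityI subsetI)
      fix T assume "T \<in> {S \<in> link V i. card (r (insert i S) - {i}) = k}"
      then obtain S where "S \<in> V" "i \<in> S" "T = S - {i}" "card (r (insert i T) - {i}) = k"
        by (auto simp: link_def)
      then show "T \<in> (\<lambda>S. S - {i}) ` {S \<in> V. i \<in> S \<and> card (r S - {i}) = k}"
        by (intro image_eqI[of _ _ S]) (simp_all add: insert_absorb)
    next
      fix T assume "T \<in> (\<lambda>S. S - {i}) ` {S \<in> V. i \<in> S \<and> card (r S - {i}) = k}"
      then obtain S where "S \<in> V" "i \<in> S" "T = S - {i}" "card (r S - {i}) = k" by blast
      then show "T \<in> {S \<in> link V i. card (r (insert i S) - {i}) = k}"
        by (auto simp: link_def insert_absorb)
    qed
  qed
  then show ?thesis by (simp add: h_number_def bij_betw_same_card)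
qed

text \<open>Both sides come from double counting the pairs of a facet \<open>S\<close> and a vertex \<open>i\<close> of \<open>S\<close> with
  \<open>card (r S - {i}) = k\<close>: for fixed \<open>i\<close> they are counted by an $h$-number of the link of \<open>i\<close>, which by
  \<open>h_number_unique\<close> may be computed from a partition whose restrictions avoid \<open>i\<close>.\<close>

lemma mcmullen_recursion:
  assumes "finite V" and V: "\<And>S. S \<in> V \<Longrightarrow> S \<subseteq> L \<and> card S = D" and "finite L"
    and r: "interval_partition V r"
    and facet: "\<And>i. i \<in> L \<Longrightarrow> \<exists>q. interval_partition V q \<and> (\<forall>S\<in>V. i \<in> S \<longrightarrow> i \<notin> q S)"
  shows "Suc k * h_number V r (Suc k) + (D - k) * h_number V r k \<le> card L * h_number V r k"
proof -
  have fin: "finite S" if "S \<in> V" for S using V[OF that] \<open>finite L\<close> finite_subset by auto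
  have rS: "r S \<subseteq> S" if "S \<in> V" for S using r that by (auto simp: interval_partition_def)
  have le: "card {S \<in> V. i \<in> S \<and> card (r S - {i}) = k} \<le> h_number V r k" if i: "i \<in> L" for i
  proof -
    obtain q where q: "interval_partition V q" "\<forall>S\<in>V. i \<in> S \<longrightarrow> i \<notin> q S" using facet[OF i] by blast
    have "card {S \<in> V. i \<in> S \<and> card (r S - {i}) = k} = card {S \<in> V. i \<in> S \<and> card (q S - {i}) = k}"
      unfolding h_number_link[symmetric]
    proof (rule h_number_unique)
      show "finite (link V i)" using \<open>finite V\<close> by (simp add: link_def)
      show "finite S \<and> card S = D - 1" if "S \<in> link V i" for S
        using that V fin by (auto simp: link_def)
    qed (rule interval_partition_link, fact)+
    \<comment> \<open>\<open>q S\<close> avoids \<open>i\<close>, so \<open>q S - {i} = q S\<close>,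
      and the facets through \<open>i\<close> are among those that \<open>h_number V q k\<close>
      counts.\<close>
    also have "\<dots> \<le> card {S \<in> V. card (q S) = k}"
      using q \<open>finite V\<close> by (intro card_mono) auto
    also have "\<dots> = h_number V r k"
      unfolding h_number_def[symmetric] using V fin q r \<open>finite V\<close>
      by (intro h_number_unique[where D = D]) auto
    finally show ?thesis .
  qed
  \<comment> \<open>Size \<open>k\<close> arises by deleting one of \<open>Suc k\<close> elements of
    \<open>r S\<close>, or from any of the \<open>D - k\<close> elements outside an
    \<open>r S\<close> that already has size \<open>k\<close>.\<close>
  have cnt: "card {i \<in> S. card (r S - {i}) = k} =
      (if card (r S) = Suc k then Suc k else 0) + (if card (r S) = k then D - k else 0)"
    if S: "S \<in> V" for S
  proof -
    have fr: "finite (r S)" using rS[OF S] fin[OF S] finite_subset by auto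
    consider "card (r S) = Suc k" | "card (r S) = k" | "card (r S) \<noteq> k" "card (r S) \<noteq> Suc k" by blast
    then show ?thesis
    proof cases
      case 1
      then have "{i \<in> S. card (r S - {i}) = k} = r S"
        using fr rS[OF S] by (auto simp: card_Diff_singleton_if split: if_splits)
      then show ?thesis using 1 by simp
    next
      case 2
      have "i \<notin> r S" if "card (r S - {i}) = k" for i
        using that 2 fr by (metis card_Diff1_less less_irrefl)
      moreover have "card (r S - {i}) = k" if "i \<notin> r S" for i
        using that 2 by simp
      ultimately have "{i \<in> S. card (r S - {i}) = k} = S - r S"
        by blast
      then show ?thesis using 2 fr rS[OF S] V[OF S] by (simp add: card_Diff_subset)
    next
      case 3
      have "card (r S - {i}) \<noteq> k" for i
        using 3 card_Suc_Diff1[OF fr, of i] by (cases "i \<in> r S") auto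
      then have "{i \<in> S. card (r S - {i}) = k} = {}"
        by blast
      then have "card {i \<in> S. card (r S - {i}) = k} = 0" by (simp only: card.empty)
      then show ?thesis using 3 by (simp only: if_False add_0)
    qed
  qed
  have "(\<Sum>i\<in>L. card {S \<in> V. i \<in> S \<and> card (r S - {i}) = k}) =
      (\<Sum>i\<in>L. \<Sum>S\<in>V. if i \<in> S \<and> card (r S - {i}) = k then 1 else 0)"
    using \<open>finite V\<close> by (simp add: sum.If_cases Int_def)
  also have "\<dots> = (\<Sum>S\<in>V. \<Sum>i\<in>L. if i \<in> S \<and> card (r S - {i}) = k then 1 else 0)"
    by (rule sum.swap)
  also have "\<dots> = (\<Sum>S\<in>V. card {i \<in> S. card (r S - {i}) = k})"
  proof (rule sum.cong)
    fix S assume "S \<in> V"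
    then have "L \<inter> {i. i \<in> S \<and> card (r S - {i}) = k} = {i \<in> S. card (r S - {i}) = k}"
      using V by auto
    then show "(\<Sum>i\<in>L. if i \<in> S \<and> card (r S - {i}) = k then 1 else 0) = card {i \<in> S. card (r S - {i}) = k}"
      using \<open>finite L\<close> by (simp add: sum.If_cases)
  qed simp
  also have "\<dots> = (\<Sum>S\<in>V. (if card (r S) = Suc k then Suc k else 0) + (if card (r S) = k then D - k else 0))"
    by (rule sum.cong) (use cnt in auto)
  also have "\<dots> = Suc k * h_number V r (Suc k) + (D - k) * h_number V r k"
    using \<open>finite V\<close> by (simp only: sum.distrib) (simp add: sum.If_cases Int_def h_number_def)
  finally have "(\<Sum>i\<in>L. card {S \<in> V. i \<in> S \<and> card (r S - {i}) = k}) =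
    Suc k * h_number V r (Suc k) + (D - k) * h_number V r k" .
  moreover have "(\<Sum>i\<in>L. card {S \<in> V. i \<in> S \<and> card (r S - {i}) = k}) \<le> (\<Sum>i\<in>L. h_number V r k)"
    by (intro sum_mono le)
  ultimately show ?thesis by simp
qed

text \<open>\<open>mcmullen_recursion\<close> bounds \<open>Suc k * h_number V r (Suc k)\<close> by
  \<open>(card L - D + k) * h_number V r k\<close>, a recursion that the binomials satisfy with
  equality. It starts at 1 because at most one interval contains the empty face.\<close>

lemma h_number_le:
  assumes "finite V" and V: "\<And>S. S \<in> V \<Longrightarrow> S \<subseteq> L \<and> card S = D" and "finite L"
    and r: "interval_partition V r"
    and facet: "\<And>i. i \<in> L \<Longrightarrow> \<exists>q. interval_partition V q \<and> (\<forall>S\<in>V. i \<in> S \<longrightarrow> i \<notin> q S)"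
    and D: "D < card L"
  shows "k \<le> D \<Longrightarrow> h_number V r k \<le> (card L - D - 1 + k) choose k"
proof (induction k)
  case 0
  have "S = T" if "S \<in> V" "r S = {}" "T \<in> V" "r T = {}" for S T
    using interval_partition_unique[OF r, of S "{}" T] that by simp
  then have "card {S \<in> V. r S = {}} \<le> Suc 0"
    using \<open>finite V\<close> by (subst card_le_Suc0_iff_eq) auto
  moreover have "{S \<in> V. card (r S) = 0} = {S \<in> V. r S = {}}"
  proof -
    have "finite (r S)" if "S \<in> V" for S
      using r that V[OF that] \<open>finite L\<close> unfolding interval_partition_def by (metis finite_subset)
    then show ?thesis by auto
  qed
  ultimately show ?case by (simp add: h_number_def)
next
  case (Suc k)
  let ?n = "card L - D - 1 + k"
  have "Suc k * h_number V r (Suc k) + (D - k) * h_number V r k \<le> card L * h_number V r k"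
    by (rule mcmullen_recursion[OF assms(1-5)])
  moreover have "card L = Suc ?n + (D - k)" using D Suc by linarith
  ultimately have "Suc k * h_number V r (Suc k) \<le> Suc ?n * h_number V r k"
    by (simp add: algebra_simps)
  also have "\<dots> \<le> Suc ?n * (?n choose k)" using Suc by (intro mult_left_mono) auto
  also have "\<dots> = Suc k * (Suc ?n choose Suc k)" by (simp only: Suc_times_binomial)
  finally show ?case by (simp only: mult_le_cancel1 add_Suc_right)
qed

section \<open>Summation to \<open>U\<close>\<close>

text \<open>Both halves of the symmetric sum are hockey-stick sums. For odd \<open>D\<close> they
  are equal; for even \<open>D\<close> the middle term occurs once, and Pascal's rule produces the
  two binomials of \<open>U\<close>.\<close>

lemma sum_binomial_eq_U:
  assumes "D < n"
  shows "(\<Sum>k\<le>D. (n - D - 1 + min k (D - k)) choose (min k (D - k))) = U n D"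
proof -
  \<comment> \<open>The case \<open>m = 0\<close> is separate: the sum is empty, while
    \<open>m - 1\<close> would truncate to 0 and give the value 1.\<close>
  have diag: "(\<Sum>k<m. (a + k) choose k) = (if m = 0 then 0 else (a + m) choose (m - 1))" for a m :: nat
    using sum_choose_lower[of a "m - 1"] by (cases m) (auto simp: lessThan_Suc_atMost)
  define a where "a = n - D - 1"
  define m where "m = D div 2"
  let ?g = "\<lambda>k. (a + k) choose k"
  show ?thesis
  proof (cases "even D")
    case True
    then have Dm: "D = 2 * m" by (simp add: m_def)
    have "{..D} = {..<m} \<union> {m..D}" by (auto simp: Dm)
    then have "(\<Sum>k\<le>D. ?g (min k (D - k))) = (\<Sum>k<m. ?g (min k (D - k))) + (\<Sum>k\<in>{m..D}. ?g (min k (D - k)))"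
      by (simp only:, subst sum.union_disjoint[symmetric]) auto
    also have "(\<Sum>k<m. ?g (min k (D - k))) = (\<Sum>k<m. ?g k)"
      by (rule sum.cong) (auto simp: Dm min_def)
    also have "(\<Sum>k\<in>{m..D}. ?g (min k (D - k))) = (\<Sum>k\<in>{m..D}. ?g (D - k))"
      by (intro sum.cong refl arg_cong[where f = ?g] min.absorb2) (auto simp: Dm)
    also have "\<dots> = (\<Sum>k\<le>m. ?g k)"
      by (rule sum.reindex_bij_witness[of _ "\<lambda>k. D - k" "\<lambda>k. D - k"]) (auto simp: Dm)
    also have "\<dots> = (\<Sum>k<m. ?g k) + ?g m" by (simp add: lessThan_Suc_atMost[symmetric])
    finally have s: "(\<Sum>k\<le>D. ?g (min k (D - k))) = 2 * (\<Sum>k<m. ?g k) + ?g m" by simp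
    have n: "n = a + 2 * m + 1" using assms by (simp add: a_def Dm)
    have "U n D = binom (int n - m) m + binom (int n - m - 1) (int m - 1)"
      using True by (simp add: U_def m_def Let_def)
    also have "binom (int n - m) m = (a + m + 1) choose m"
      by (auto simp: binom_def n nat_diff_distrib nat_add_distrib algebra_simps)
    also have "binom (int n - m - 1) (int m - 1) = (if m = 0 then 0 else (a + m) choose (m - 1))"
      by (auto simp: binom_def n nat_diff_distrib nat_add_distrib algebra_simps)
    finally show ?thesis
      unfolding a_def[symmetric] s diag by (cases m) auto
  next
    case False
    then have Dm: "D = 2 * m + 1" by (simp add: m_def)
    have "{..D} = {..m} \<union> {Suc m..D}" by (auto simp: Dm)
    then have "(\<Sum>k\<le>D. ?g (min k (D - k))) = (\<Sum>k\<le>m. ?g (min k (D - k))) + (\<Sum>k\<in>{Suc m..D}. ?g (min k (D - k)))"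
      by (simp only:, subst sum.union_disjoint[symmetric]) auto
    also have "(\<Sum>k\<le>m. ?g (min k (D - k))) = (\<Sum>k\<le>m. ?g k)"
      by (rule sum.cong) (auto simp: Dm min_def)
    also have "(\<Sum>k\<in>{Suc m..D}. ?g (min k (D - k))) = (\<Sum>k\<in>{Suc m..D}. ?g (D - k))"
      by (intro sum.cong refl arg_cong[where f = ?g] min.absorb2) (auto simp: Dm)
    also have "\<dots> = (\<Sum>k\<le>m. ?g k)"
      by (rule sum.reindex_bij_witness[of _ "\<lambda>k. D - k" "\<lambda>k. D - k"]) (auto simp: Dm)
    finally have s: "(\<Sum>k\<le>D. ?g (min k (D - k))) = 2 * ((a + m + 1) choose m)"
      by (simp add: sum_choose_lower)
    have n: "n = a + 2 * m + 2" using assms by (simp add: a_def Dm)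
    have "binom (int n - m - 1) m = (a + m + 1) choose m"
      by (auto simp: binom_def n nat_diff_distrib nat_add_distrib algebra_simps)
    then show ?thesis
      unfolding a_def[symmetric] s using False by (simp add: U_def m_def Let_def)
  qed
qed

text \<open>As \<open>r\<close> and its complement are both interval partitions,
  \<open>h_number_unique\<close> gives the symmetry between \<open>k\<close> and
  \<open>D - k\<close>, so each h-number can be bounded at the smaller of the two indices.\<close>

lemma upper_bound_interval_partition:
  assumes "finite V" and V: "\<And>S. S \<in> V \<Longrightarrow> S \<subseteq> L \<and> card S = D" and "finite L"
    and r: "interval_partition V r" "interval_partition V (\<lambda>S. S - r S)"
    and facet: "\<And>i. i \<in> L \<Longrightarrow> \<exists>q. interval_partition V q \<and> (\<forall>S\<in>V. i \<in> S \<longrightarrow> i \<notin> q S)"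
    and D: "D < card L"
  shows "card V \<le> U (card L) D"
proof -
  have fin: "finite S" if "S \<in> V" for S using V[OF that] \<open>finite L\<close> finite_subset by auto
  have rS: "r S \<subseteq> S" if "S \<in> V" for S using r that by (auto simp: interval_partition_def)
  have card_r: "card (S - r S) = D - card (r S)" "card (r S) \<le> D" if "S \<in> V" for S
    using rS[OF that] fin[OF that] V[OF that] by (auto simp: card_Diff_subset finite_subset card_mono)
  have sym: "h_number V r (D - k) = h_number V r k" if "k \<le> D" for k
  proof -
    have "h_number V r k = h_number V (\<lambda>S. S - r S) k"
      using V fin r \<open>finite V\<close> by (intro h_number_unique[where D = D]) auto
    also have "{S \<in> V. card (S - r S) = k} = {S \<in> V. card (r S) = D - k}"
      using card_r that by fastforce
    then have "h_number V (\<lambda>S. S - r S) k = h_number V r (D - k)" by (simp add: h_number_def)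
    finally show ?thesis by simp
  qed
  have "card V = card (\<Union>k\<le>D. {S \<in> V. card (r S) = k})"
    using card_r by (intro arg_cong[where f = card]) auto
  also have "\<dots> = (\<Sum>k\<le>D. h_number V r k)"
    unfolding h_number_def using \<open>finite V\<close> by (intro card_UN_disjoint) auto
  also have "\<dots> \<le> (\<Sum>k\<le>D. (card L - D - 1 + min k (D - k)) choose (min k (D - k)))"
  proof (rule sum_mono)
    fix k assume "k \<in> {..D}"
    then have "h_number V r k = h_number V r (min k (D - k))" using sym by (auto simp: min_def)
    also have "\<dots> \<le> (card L - D - 1 + min k (D - k)) choose (min k (D - k))"
      using \<open>k \<in> {..D}\<close> by (intro h_number_le[OF assms(1-3) r(1) facet D]) auto
    finally show "h_number V r k \<le> \<dots>" .
  qed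
  also have "\<dots> = U (card L) D" using D by (rule sum_binomial_eq_U)
  finally show ?thesis .
qed

section \<open>Cones in general position\<close>

lemma ex_orthogonal:
  fixes S :: "'a::euclidean_space set"
  assumes "finite S" "card S < DIM('a)"
  obtains x where "x \<noteq> 0" "\<And>y. y \<in> S \<Longrightarrow> y \<bullet> x = 0"
proof -
  have "dim S < DIM('a)" using dim_le_card'[OF assms(1)] assms(2) by linarith
  then obtain x where "x \<noteq> 0" "\<And>y. y \<in> span S \<Longrightarrow> orthogonal x y"
    using orthogonal_to_subspace_exists by blast
  then show thesis using that by (simp add: orthogonal_def inner_commute span_base)
qed

text \<open>Finitely many hyperplanes and points form a negligible set, which cannot cover a
  nonempty open set.\<close>

lemma open_avoids_hyperplanes:
  fixes W L :: "'a::euclidean_space set"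
  assumes "open O'" "O' \<noteq> {}" "finite W" "0 \<notin> W" "finite L"
  obtains f where "f \<in> O'" "f \<notin> L" "\<And>w. w \<in> W \<Longrightarrow> f \<bullet> w \<noteq> 0"
proof -
  have "negligible {f. w \<bullet> f = 0}" if "w \<in> W" for w
    using that assms(4) by (intro negligible_hyperplane) auto
  then have "negligible (\<Union>w\<in>W. {f. w \<bullet> f = 0})"
    using assms(3) by (intro negligible_Union) auto
  then have "negligible ((\<Union>w\<in>W. {f. w \<bullet> f = 0}) \<union> L)"
    by (rule negligible_Un[OF _ negligible_finite[OF assms(5)]])
  then have "\<not> O' \<subseteq> (\<Union>w\<in>W. {f. w \<bullet> f = 0}) \<union> L"
    using open_not_negligible[OF assms(1,2)] negligible_subset by blast
  then obtain f where "f \<in> O'" "f \<notin> L" "\<forall>w\<in>W. w \<bullet> f \<noteq> 0" by blast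
  then show thesis using that[of f] by (simp add: inner_commute)
qed

text \<open>For finite \<open>L\<close>: every subset of \<open>DIM('a)\<close> elements is linearly
  independent, phrased through common zeros.\<close>

definition general_position :: "'a::euclidean_space set \<Rightarrow> bool"
  where "general_position L \<longleftrightarrow> (\<forall>x. x \<noteq> 0 \<longrightarrow> card {l \<in> L. l \<bullet> x = 0} < DIM('a))"

text \<open>Subtract from \<open>x\<close> the multiple of \<open>w\<close> that agrees with it on
  some basis vector \<open>k\<close> with \<open>k \<bullet> w \<noteq> 0\<close>. The difference is
  killed by \<open>S\<close> and by \<open>k\<close>, which is not in \<open>S\<close>: too many
  functionals for a nonzero vector.\<close>

lemma general_position_proportional:
  fixes L :: "'a::euclidean_space set"
  assumes L: "finite L" "Basis \<subseteq> L" "general_position L"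
    and S: "S \<subseteq> L" "DIM('a) \<le> Suc (card S)"
    and w: "w \<noteq> 0" "\<And>l. l \<in> S \<Longrightarrow> l \<bullet> w = 0" and x: "\<And>l. l \<in> S \<Longrightarrow> l \<bullet> x = 0"
  shows "\<exists>c. x = c *\<^sub>R w"
proof -
  obtain k where k: "k \<in> Basis" "k \<bullet> w \<noteq> 0" using w(1) by (metis euclidean_all_zero_iff inner_commute)
  define y where "y = x - ((k \<bullet> x) / (k \<bullet> w)) *\<^sub>R w"
  have "insert k S \<subseteq> {l \<in> L. l \<bullet> y = 0}"
    using k S w x L by (auto simp: y_def inner_diff_right)
  then have "card (insert k S) \<le> card {l \<in> L. l \<bullet> y = 0}"
    using L by (intro card_mono) auto
  moreover have "k \<notin> S" "finite S" using k w S L finite_subset by auto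
  ultimately have "y = 0"
    using L(3) S unfolding general_position_def by fastforce
  then show ?thesis unfolding y_def by (intro exI[of _ "(k \<bullet> x) / (k \<bullet> w)"]) simp
qed

lemma general_position_Basis: "general_position (Basis :: 'a::euclidean_space set)"
  unfolding general_position_def
proof (intro allI impI)
  fix x :: 'a assume "x \<noteq> 0"
  then have "{l \<in> Basis. l \<bullet> x = 0} \<subset> Basis"
    by (metis (mono_tags, lifting) euclidean_all_zero_iff inner_commute mem_Collect_eq psubsetI subsetI)
  then show "card {l \<in> Basis. l \<bullet> x = 0} < DIM('a)"
    by (intro psubset_card_mono) auto
qed

text \<open>Each set of \<open>DIM('a) - 1\<close> elements of \<open>L\<close> has a
  one-dimensional common kernel. It suffices that \<open>m\<close> is nonzero on each of these
  finitely many lines.\<close>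

lemma general_position_insert:
  fixes L :: "'a::euclidean_space set"
  assumes L: "finite L" "Basis \<subseteq> L" "general_position L" and O': "open O'" "O' \<noteq> {}"
  obtains m where "m \<in> O'" "m \<notin> L" "general_position (insert m L)"
proof -
  define F where "F = {S. S \<subseteq> L \<and> Suc (card S) = DIM('a)}"
  have finF: "finite F" using L(1) by (auto simp: F_def)
  have "\<exists>w. w \<noteq> 0 \<and> (\<forall>l\<in>S. l \<bullet> w = 0)" if "S \<in> F" for S
  proof -
    have "finite S" "card S < DIM('a)" using that L(1) by (auto simp: F_def finite_subset)
    then show ?thesis by (rule ex_orthogonal) blast
  qed
  then obtain w where w: "\<And>S. S \<in> F \<Longrightarrow> w S \<noteq> 0" "\<And>S l. S \<in> F \<Longrightarrow> l \<in> S \<Longrightarrow> l \<bullet> w S = 0"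
    by metis
  have "finite (w ` F)" "0 \<notin> w ` F" using finF w by auto
  then obtain m where m: "m \<in> O'" "m \<notin> L" "\<And>v. v \<in> w ` F \<Longrightarrow> m \<bullet> v \<noteq> 0"
    using open_avoids_hyperplanes[OF O' _ _ L(1)] by blast
  have "general_position (insert m L)"
    unfolding general_position_def
  proof (intro allI impI)
    fix x :: 'a assume x: "x \<noteq> 0"
    let ?Z = "{l \<in> L. l \<bullet> x = 0}"
    have lt: "card ?Z < DIM('a)" using L(3) x by (simp add: general_position_def)
    show "card {l \<in> insert m L. l \<bullet> x = 0} < DIM('a)"
    proof (cases "m \<bullet> x = 0")
      case False
      then have "{l \<in> insert m L. l \<bullet> x = 0} = ?Z" by auto
      then show ?thesis using lt by simp
    next
      case True
      then have eq: "{l \<in> insert m L. l \<bullet> x = 0} = insert m ?Z" by auto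
      have "Suc (card ?Z) \<noteq> DIM('a)"
      proof
        assume "Suc (card ?Z) = DIM('a)"
        then have Z: "?Z \<in> F" by (simp add: F_def)
        define z where "z = w ?Z"
        have "\<exists>c. x = c *\<^sub>R z"
        proof (rule general_position_proportional[OF L])
          show "?Z \<subseteq> L" "DIM('a) \<le> Suc (card ?Z)" using Z by (auto simp: F_def)
        qed (use w[OF Z] in \<open>auto simp: z_def\<close>)
        then obtain c where "x = c *\<^sub>R z" by blast
        then have "m \<bullet> z = 0" using True x by auto
        then show False using m(3) Z by (simp add: z_def)
      qed
      then show ?thesis using eq lt m(2) L(1) by simp
    qed
  qed
  then show thesis using that m by blast
qed

text \<open>Functionals are added one at a time, each outside the set built so far, so the
  cardinality that enters the bound is exact.\<close>

lemma general_position_extend: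
  fixes O' :: "'i \<Rightarrow> 'a::euclidean_space set"
  assumes "finite I" "\<And>i. i \<in> I \<Longrightarrow> open (O' i)" "\<And>i. i \<in> I \<Longrightarrow> O' i \<noteq> {}"
  shows "\<exists>m. (\<forall>i\<in>I. m i \<in> O' i) \<and> general_position (Basis \<union> m ` I) \<and>
    card (Basis \<union> m ` I) = card I + DIM('a)"
  using assms
proof (induction I rule: finite_induct)
  case empty
  show ?case using general_position_Basis by auto
next
  case (insert i I)
  then obtain m where m: "\<forall>j\<in>I. m j \<in> O' j" "general_position (Basis \<union> m ` I)"
    "card (Basis \<union> m ` I) = card I + DIM('a)" by auto
  have "finite (Basis \<union> m ` I)" "Basis \<subseteq> Basis \<union> m ` I" using insert by auto
  then obtain v where v: "v \<in> O' i" "v \<notin> Basis \<union> m ` I" "general_position (insert v (Basis \<union> m ` I))"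
    using general_position_insert[OF _ _ m(2)] insert by (metis insertI1)
  have im: "Basis \<union> (m(i := v)) ` insert i I = insert v (Basis \<union> m ` I)"
    using insert by auto
  show ?case
  proof (intro exI[of _ "m(i := v)"] conjI)
    show "\<forall>j\<in>insert i I. (m(i := v)) j \<in> O' j" using m v insert by auto
    show "general_position (Basis \<union> (m(i := v)) ` insert i I)" using im v by simp
    show "card (Basis \<union> (m(i := v)) ` insert i I) = card (insert i I) + DIM('a)"
      unfolding im using insert m v by simp
  qed
qed

section \<open>Polyhedral cones and their vertices\<close>

text \<open>The constraints in \<open>Basis\<close> put the cone inside the nonnegative orthant, so
  \<open>One\<close> is positive on its nonzero vectors and the slice
  \<open>One \<bullet> x = 1\<close> is a polytope; general position makes it simple.\<close>

locale generic_cone =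
  fixes L :: "'a::euclidean_space set"
  assumes finite_L: "finite L" and Basis_L: "Basis \<subseteq> L" and general: "general_position L"
begin

definition zeros :: "'a \<Rightarrow> 'a set" where "zeros x = {l \<in> L. l \<bullet> x = 0}"

definition feasible_cone :: "'a set" where "feasible_cone = {x. \<forall>l\<in>L. 0 \<le> l \<bullet> x}"

text \<open>A nonzero vector has at most \<open>DIM('a) - 1\<close> active constraints; equality
  singles out the extreme rays, each represented by its point on the slice.\<close>

definition vertices :: "'a set"
  where "vertices = {x \<in> feasible_cone. One \<bullet> x = 1 \<and> Suc (card (zeros x)) = DIM('a)}"

definition vertex_sets :: "'a set set" where "vertex_sets = zeros ` vertices"

lemma finite_zeros: "finite (zeros x)"
  using finite_L by (simp add: zeros_def)

lemma card_zeros: "x \<noteq> 0 \<Longrightarrow> card (zeros x) < DIM('a)"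
  using general by (simp add: zeros_def general_position_def)

lemma proportional:
  assumes "v \<in> vertices" "\<And>l. l \<in> zeros v \<Longrightarrow> l \<bullet> x = 0"
  shows "x = (One \<bullet> x) *\<^sub>R v"
proof -
  have "v \<noteq> 0" using assms by (auto simp: vertices_def)
  have "\<exists>c. x = c *\<^sub>R v"
  proof (rule general_position_proportional[OF finite_L Basis_L general])
    show "zeros v \<subseteq> L" "DIM('a) \<le> Suc (card (zeros v))" "\<And>l. l \<in> zeros v \<Longrightarrow> l \<bullet> v = 0"
      using assms(1) by (auto simp: vertices_def zeros_def)
  qed (use assms \<open>v \<noteq> 0\<close> in auto)
  then obtain c where "x = c *\<^sub>R v" by blast
  then show ?thesis using assms by (simp add: vertices_def)
qed

lemma vertex_eqI:
  assumes "v \<in> vertices" "w \<in> vertices" "zeros v \<subseteq> zeros w"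
  shows "v = w"
  using proportional[OF assms(1), of w] assms by (auto simp: vertices_def zeros_def)

lemma inj_on_zeros: "inj_on zeros vertices"
  by (rule inj_onI) (simp add: vertex_eqI)

lemma finite_vertex_sets: "finite vertex_sets"
proof (rule finite_subset)
  show "vertex_sets \<subseteq> Pow L" by (auto simp: vertex_sets_def zeros_def)
qed (simp add: finite_L)

lemma finite_vertices: "finite vertices"
  using finite_vertex_sets inj_on_zeros unfolding vertex_sets_def by (simp add: finite_image_iff)

lemma One_pos:
  assumes "x \<in> feasible_cone" "x \<noteq> 0"
  shows "0 < One \<bullet> x"
proof -
  have nn: "0 \<le> b \<bullet> x" if "b \<in> Basis" for b using assms that Basis_L by (auto simp: feasible_cone_def)
  obtain k where k: "k \<in> Basis" "k \<bullet> x \<noteq> 0" using assms(2) by (metis euclidean_all_zero_iff inner_commute)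
  have "0 < (\<Sum>b\<in>Basis. b \<bullet> x)"
    using nn k by (intro sum_pos2[of _ k]) (auto simp: less_le)
  then show ?thesis by (simp add: inner_sum_left)
qed

text \<open>The pivot step of the simplex method: move from \<open>x\<close> along \<open>u\<close>
  until a constraint becomes tight. One does, since a nonzero \<open>u\<close> with
  \<open>One \<bullet> u = 0\<close> cannot lie in the cone.\<close>

lemma ratio_test:
  assumes x: "x \<in> feasible_cone" and u: "u \<noteq> 0" "One \<bullet> u = 0" "\<And>l. l \<in> zeros x \<Longrightarrow> 0 \<le> l \<bullet> u"
  obtains t l where "0 < t" "x + t *\<^sub>R u \<in> feasible_cone" "l \<in> L" "l \<bullet> u < 0" "l \<bullet> (x + t *\<^sub>R u) = 0"
proof -
  define N where "N = {l \<in> L. l \<bullet> u < 0}"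
  have "N \<noteq> {}"
  proof
    assume "N = {}"
    then have "u \<in> feasible_cone" by (auto simp: N_def feasible_cone_def not_less)
    then show False using One_pos u by fastforce
  qed
  have "finite N" using finite_L by (simp add: N_def)
  define q where "q l = (l \<bullet> x) / - (l \<bullet> u)" for l
  have "Min (q ` N) \<in> q ` N" using \<open>N \<noteq> {}\<close> \<open>finite N\<close> by (intro Min_in) auto
  then obtain l where l: "l \<in> N" "q l = Min (q ` N)" by force
  then have min: "q l \<le> q k" if "k \<in> N" for k using that \<open>finite N\<close> by simp
  have lN: "l \<in> L" "l \<bullet> u < 0" using l by (auto simp: N_def)
  have "l \<bullet> x > 0" using u(3)[of l] lN x by (force simp: zeros_def feasible_cone_def less_le)
  then have pos: "0 < q l" using lN by (simp add: q_def divide_pos_neg)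
  have "0 \<le> k \<bullet> (x + q l *\<^sub>R u)" if "k \<in> L" for k
  proof (cases "k \<in> N")
    case True
    then have "k \<bullet> u < 0" by (simp add: N_def)
    then have "q l * - (k \<bullet> u) \<le> k \<bullet> x"
      using min[OF True, unfolded q_def[of k]] by (simp only: pos_le_divide_eq neg_0_less_iff_less)
    then show ?thesis by (simp add: inner_add_right)
  next
    case False
    then have "0 \<le> k \<bullet> u" "0 \<le> k \<bullet> x" using that x by (auto simp: N_def feasible_cone_def)
    then show ?thesis using pos by (simp add: inner_add_right)
  qed
  then have "x + q l *\<^sub>R u \<in> feasible_cone" by (simp add: feasible_cone_def)
  moreover have "l \<bullet> (x + q l *\<^sub>R u) = 0" using lN by (simp add: q_def inner_diff_right)
  ultimately show thesis using that pos lN by blast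
qed

text \<open>Induction on the number of inactive constraints. Unless \<open>x\<close> is 0 or a
  multiple of a vertex, some line through \<open>x\<close> keeps \<open>One\<close> and all active
  constraints fixed; moving both ways until another becomes tight makes \<open>x\<close> a convex
  combination of two points covered by induction.\<close>

lemma cone_generated:
  assumes "x \<in> feasible_cone"
  shows "\<exists>c. (\<forall>v\<in>vertices. 0 \<le> c v) \<and> x = (\<Sum>v\<in>vertices. c v *\<^sub>R v)"
  using assms
proof (induction "card L - card (zeros x)" arbitrary: x rule: less_induct)
  case less
  show ?case
  proof (cases "x = 0")
    case True
    then show ?thesis by (intro exI[of _ "\<lambda>_. 0"]) simp
  next
    case x0: False
    then have One: "0 < One \<bullet> x" using One_pos less by simp
    show ?thesis
    proof (cases "Suc (card (zeros x)) = DIM('a)")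
      case True
      define v where "v = (1 / (One \<bullet> x)) *\<^sub>R x"
      have "zeros v = zeros x" using One by (auto simp: zeros_def v_def)
      then have "v \<in> vertices" using True One less(2) by (auto simp: vertices_def feasible_cone_def v_def)
      then show ?thesis using One finite_vertices
        by (intro exI[of _ "\<lambda>w. if w = v then One \<bullet> x else 0"])
          (simp add: if_distrib[of "\<lambda>a. a *\<^sub>R _"] v_def cong: if_cong)
    next
      case False
      moreover have "card (insert One (zeros x)) \<le> Suc (card (zeros x))"
        by (simp add: card_insert_if finite_zeros)
      ultimately have "card (insert One (zeros x)) < DIM('a)"
        using card_zeros[OF x0] by linarith
      moreover have "finite (insert One (zeros x))" by (simp add: finite_zeros)
      ultimately obtain u where u: "u \<noteq> 0" "\<And>y. y \<in> insert One (zeros x) \<Longrightarrow> y \<bullet> u = 0"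
        using ex_orthogonal by blast
      have step: "\<exists>t>0. \<exists>c. (\<forall>v\<in>vertices. 0 \<le> c v) \<and> x + t *\<^sub>R w = (\<Sum>v\<in>vertices. c v *\<^sub>R v)"
        if w: "w = u \<or> w = - u" for w
      proof -
        have w': "w \<noteq> 0" "One \<bullet> w = 0" "\<And>l. l \<in> zeros x \<Longrightarrow> l \<bullet> w = 0" using w u by auto
        then obtain t l where t: "0 < t" "x + t *\<^sub>R w \<in> feasible_cone" "l \<in> L" "l \<bullet> w < 0" "l \<bullet> (x + t *\<^sub>R w) = 0"
          using ratio_test[OF less(2), of w] by (metis order_refl)
        have "zeros x \<subseteq> zeros (x + t *\<^sub>R w)" using w' by (auto simp: zeros_def inner_add_right)
        moreover have "l \<in> zeros (x + t *\<^sub>R w)" "l \<notin> zeros x" using t w' by (auto simp: zeros_def)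
        ultimately have "card (zeros x) < card (zeros (x + t *\<^sub>R w))"
          using finite_zeros by (intro psubset_card_mono) auto
        moreover have "card (zeros (x + t *\<^sub>R w)) \<le> card L"
          using finite_L by (intro card_mono) (auto simp: zeros_def)
        ultimately show ?thesis using less(1)[OF _ t(2)] t(1) by (metis diff_less_mono2 order_less_le_trans)
      qed
      obtain t c where t: "0 < t" "\<forall>v\<in>vertices. 0 \<le> c v" "x + t *\<^sub>R u = (\<Sum>v\<in>vertices. c v *\<^sub>R v)"
        using step[of u] by auto
      obtain s e where s: "0 < s" "\<forall>v\<in>vertices. 0 \<le> e v" "x - s *\<^sub>R u = (\<Sum>v\<in>vertices. e v *\<^sub>R v)"
        using step[of "- u"] by auto
      have "(s + t) *\<^sub>R x = s *\<^sub>R (x + t *\<^sub>R u) + t *\<^sub>R (x - s *\<^sub>R u)"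
        by (simp add: algebra_simps)
      then have "x = (1 / (s + t)) *\<^sub>R (s *\<^sub>R (x + t *\<^sub>R u) + t *\<^sub>R (x - s *\<^sub>R u))"
        using t(1) s(1)
        by (metis add_pos_pos divide_self_if less_irrefl scaleR_one scaleR_scaleR times_divide_eq_left mult_1)
      also have "\<dots> = (\<Sum>v\<in>vertices. ((s * c v + t * e v) / (s + t)) *\<^sub>R v)"
        unfolding t(3) s(3)
        by (simp add: scaleR_sum_right scaleR_add_left sum.distrib add_divide_distrib scaleR_add_right)
      finally show ?thesis using t s
        by (intro exI[of _ "\<lambda>v. (s * c v + t * e v) / (s + t)"]) (simp add: divide_nonneg_pos)
    qed
  qed
qed

text \<open>The other active constraints and \<open>One\<close> number fewer than
  \<open>DIM('a)\<close>, so they vanish at a common nonzero \<open>u\<close>. If \<open>i\<close>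
  vanished there too, \<open>u\<close> would be a multiple of \<open>v\<close>, hence 0 because
  \<open>One \<bullet> u = 0\<close>.\<close>

lemma ex_edge:
  assumes v: "v \<in> vertices" and i: "i \<in> zeros v"
  shows "\<exists>u. One \<bullet> u = 0 \<and> i \<bullet> u = 1 \<and> (\<forall>l\<in>zeros v - {i}. l \<bullet> u = 0)"
proof -
  have "card (insert One (zeros v - {i})) \<le> Suc (card (zeros v - {i}))"
    by (simp add: card_insert_if finite_zeros)
  then have "card (insert One (zeros v - {i})) < DIM('a)"
    using v card_Suc_Diff1[OF finite_zeros i] by (simp add: vertices_def)
  moreover have "finite (insert One (zeros v - {i}))" by (simp add: finite_zeros)
  ultimately obtain u where u: "u \<noteq> 0" "\<And>y. y \<in> insert One (zeros v - {i}) \<Longrightarrow> y \<bullet> u = 0"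
    using ex_orthogonal by blast
  have "i \<bullet> u \<noteq> 0"
  proof
    assume "i \<bullet> u = 0"
    then have "u = (One \<bullet> u) *\<^sub>R v" using u by (intro proportional[OF v]) auto
    then show False using u by simp
  qed
  then show ?thesis using u by (intro exI[of _ "(1 / (i \<bullet> u)) *\<^sub>R u"]) auto
qed

text \<open>The direction of the edge leaving the vertex with zero set \<open>S\<close> when the constraint \<open>i\<close> is relaxed; these
  directions are the basis dual to the functionals in \<open>S\<close> on the hyperplane \<open>One \<bullet> u = 0\<close>.\<close>

definition edge :: "'a set \<Rightarrow> 'a \<Rightarrow> 'a"
  where "edge S i = (SOME u. One \<bullet> u = 0 \<and> i \<bullet> u = 1 \<and> (\<forall>l\<in>S - {i}. l \<bullet> u = 0))"

lemma edge:
  assumes "v \<in> vertices" "i \<in> zeros v"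
  shows "One \<bullet> edge (zeros v) i = 0" "i \<bullet> edge (zeros v) i = 1"
    "\<And>l. l \<in> zeros v \<Longrightarrow> l \<noteq> i \<Longrightarrow> l \<bullet> edge (zeros v) i = 0"
  using someI_ex[OF ex_edge[OF assms]] unfolding edge_def by auto

text \<open>The difference of the two sides is killed by \<open>zeros v\<close> and by
  \<open>One\<close>, so \<open>proportional\<close> makes it 0.\<close>

lemma edge_expansion:
  assumes v: "v \<in> vertices" and x: "One \<bullet> x = 1"
  shows "x = v + (\<Sum>i\<in>zeros v. (i \<bullet> x) *\<^sub>R edge (zeros v) i)"
proof -
  define y where "y = x - v - (\<Sum>i\<in>zeros v. (i \<bullet> x) *\<^sub>R edge (zeros v) i)"
  have "One \<bullet> y = 0"
    using v x edge(1)[OF v] by (simp add: y_def inner_diff_right inner_sum_right vertices_def)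
  moreover have "l \<bullet> y = 0" if l: "l \<in> zeros v" for l
  proof -
    have "(\<Sum>i\<in>zeros v. (i \<bullet> x) * (l \<bullet> edge (zeros v) i)) = (\<Sum>i\<in>zeros v. if i = l then l \<bullet> x else 0)"
      using edge[OF v] l by (intro sum.cong) auto
    then show ?thesis
      using l finite_zeros by (simp add: y_def inner_diff_right inner_sum_right zeros_def)
  qed
  ultimately have "y = 0" using proportional[OF v, of y] by simp
  then show ?thesis by (simp add: y_def algebra_simps)
qed

section \<open>Generic objectives and descents\<close>

definition generic :: "'a \<Rightarrow> bool"
  where "generic f \<longleftrightarrow> (\<forall>S\<in>vertex_sets. \<forall>i\<in>S. f \<bullet> edge S i \<noteq> 0)"

definition descents :: "'a \<Rightarrow> 'a set \<Rightarrow> 'a set"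
  where "descents f S = {i \<in> S. f \<bullet> edge S i < 0}"

text \<open>In the expansion of \<open>x\<close> at \<open>v\<close>, descending edges have
  coefficient 0 because the elements of \<open>R\<close> vanish at \<open>x\<close>, and every other
  edge ascends. So \<open>f \<bullet> x\<close> is at least \<open>f \<bullet> v\<close>, with
  equality only at \<open>v\<close>.\<close>

lemma descents_minimum:
  assumes f: "generic f" and v: "v \<in> vertices" and R: "descents f (zeros v) \<subseteq> R"
    and x: "x \<in> feasible_cone" "One \<bullet> x = 1" "R \<subseteq> zeros x" and le: "f \<bullet> x \<le> f \<bullet> v"
  shows "x = v"
proof -
  have pos: "0 < f \<bullet> edge (zeros v) i" if i: "i \<in> zeros v" "i \<notin> R" for i
  proof -
    have "f \<bullet> edge (zeros v) i \<noteq> 0" using f v i by (auto simp: generic_def vertex_sets_def)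
    moreover have "\<not> f \<bullet> edge (zeros v) i < 0" using R i by (auto simp: descents_def)
    ultimately show ?thesis by linarith
  qed
  have nn: "0 \<le> (i \<bullet> x) * (f \<bullet> edge (zeros v) i)" if "i \<in> zeros v" for i
    using pos[of i] that x by (cases "i \<in> R") (auto simp: zeros_def feasible_cone_def)
  have "f \<bullet> x = f \<bullet> v + (\<Sum>i\<in>zeros v. (i \<bullet> x) * (f \<bullet> edge (zeros v) i))"
    by (subst edge_expansion[OF v x(2)]) (simp add: inner_add_right inner_sum_right)
  then have "(\<Sum>i\<in>zeros v. (i \<bullet> x) * (f \<bullet> edge (zeros v) i)) = 0"
    using le sum_nonneg[of "zeros v" "\<lambda>i. (i \<bullet> x) * (f \<bullet> edge (zeros v) i)", OF nn] by linarith
  then have "(i \<bullet> x) * (f \<bullet> edge (zeros v) i) = 0" if "i \<in> zeros v" for i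
    using sum_nonneg_eq_0_iff[OF finite_zeros nn] that by auto
  then have "i \<bullet> x = 0" if "i \<in> zeros v" for i
    using pos[of i] that x(3) by (cases "i \<in> R") (force simp: zeros_def)+
  then show ?thesis using proportional[OF v, of x] x by simp
qed

text \<open>The interval of \<open>R\<close> belongs to the vertex minimising \<open>f\<close> on
  the face of the slice where \<open>R\<close> is tight: minimality puts its descents in
  \<open>R\<close>, and \<open>descents_minimum\<close> makes it unique.\<close>

lemma interval_partition_descents:
  assumes f: "generic f"
  shows "interval_partition vertex_sets (descents f)"
  unfolding interval_partition_def
proof (intro conjI ballI allI impI)
  show "descents f S \<subseteq> S" for S by (auto simp: descents_def)
  fix S R assume "S \<in> vertex_sets" "R \<subseteq> S"
  then obtain v0 where v0: "v0 \<in> vertices" "R \<subseteq> zeros v0" by (auto simp: vertex_sets_def)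
  define W where "W = {v \<in> vertices. R \<subseteq> zeros v}"
  have "finite W" "W \<noteq> {}" using finite_vertices v0 by (auto simp: W_def)
  then have "Min ((\<bullet>) f ` W) \<in> (\<bullet>) f ` W" by (intro Min_in) auto
  then obtain v where v: "v \<in> W" "f \<bullet> v = Min ((\<bullet>) f ` W)" by force
  then have min: "f \<bullet> v \<le> f \<bullet> w" if "w \<in> W" for w using that \<open>finite W\<close> by simp
  have vv: "v \<in> vertices" "R \<subseteq> zeros v" using v by (auto simp: W_def)
  have "i \<in> R" if i: "i \<in> descents f (zeros v)" for i
  proof (rule ccontr)
    assume "i \<notin> R"
    let ?u = "edge (zeros v) i"
    have iv: "i \<in> zeros v" "f \<bullet> ?u < 0" using i by (auto simp: descents_def)
    note u = edge[OF vv(1) iv(1)]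
    have "v \<in> feasible_cone" "?u \<noteq> 0" using vv u(2) by (auto simp: vertices_def)
    moreover have "0 \<le> l \<bullet> ?u" if "l \<in> zeros v" for l using u(2) u(3)[of l] that by (cases "l = i") auto
    ultimately obtain t l where t: "0 < t" "v + t *\<^sub>R ?u \<in> feasible_cone" "l \<in> L" "l \<bullet> ?u < 0" "l \<bullet> (v + t *\<^sub>R ?u) = 0"
      using ratio_test[of v ?u] u(1) by metis
    let ?w = "v + t *\<^sub>R ?u"
    have One: "One \<bullet> ?w = 1" using vv u(1) by (simp add: vertices_def inner_add_right)
    then have w0: "?w \<noteq> 0" by force
    have "l \<notin> zeros v" using t(4) u(2) u(3)[of l] by (cases "l = i") auto
    have sub: "zeros v - {i} \<subseteq> zeros ?w" using u(3) by (auto simp: zeros_def inner_add_right)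
    \<comment> \<open>Along the edge \<open>i\<close> is lost and \<open>l\<close> gained; general
      position allows no further tight constraint, so the endpoint is a vertex, below
      \<open>v\<close> and still on the face of \<open>R\<close>.\<close>
    have "insert l (zeros v - {i}) \<subseteq> zeros ?w" using sub t by (auto simp: zeros_def)
    then have "card (insert l (zeros v - {i})) \<le> card (zeros ?w)"
      using finite_zeros by (intro card_mono)
    moreover have "card (insert l (zeros v - {i})) = card (zeros v)"
      using \<open>l \<notin> zeros v\<close> card_Suc_Diff1[OF finite_zeros iv(1)] finite_zeros by simp
    ultimately have "Suc (card (zeros ?w)) = DIM('a)"
      using card_zeros[OF w0] vv by (auto simp: vertices_def)
    then have "?w \<in> W" using One t(2) sub vv(2) \<open>i \<notin> R\<close> by (auto simp: W_def vertices_def)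
    then have "f \<bullet> v \<le> f \<bullet> ?w" by (rule min)
    then show False using t(1) iv(2) by (simp add: inner_add_right zero_le_mult_iff)
  qed
  then have desc: "descents f (zeros v) \<subseteq> R" by blast
  show "\<exists>!T. T \<in> vertex_sets \<and> descents f T \<subseteq> R \<and> R \<subseteq> T"
  proof (rule ex1I[of _ "zeros v"])
    show "zeros v \<in> vertex_sets \<and> descents f (zeros v) \<subseteq> R \<and> R \<subseteq> zeros v"
      using desc vv by (auto simp: vertex_sets_def)
    fix T assume T: "T \<in> vertex_sets \<and> descents f T \<subseteq> R \<and> R \<subseteq> T"
    then obtain w where w: "w \<in> vertices" "T = zeros w" by (auto simp: vertex_sets_def)
    have "w \<in> W" using T w by (auto simp: W_def)
    then have "v = w"
      using descents_minimum[OF f w(1), of R v] T w vv min by (auto simp: vertices_def)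
    then show "T = zeros v" using w by simp
  qed
qed

lemma ex_generic:
  assumes "open O'" "O' \<noteq> {}"
  obtains f where "f \<in> O'" "generic f"
proof -
  define W where "W = (\<Union>S\<in>vertex_sets. edge S ` S)"
  have "finite W" unfolding W_def using finite_vertex_sets
    by (rule finite_UN_I) (auto simp: vertex_sets_def finite_zeros)
  moreover have "0 \<notin> W" using edge(2) by (fastforce simp: W_def vertex_sets_def)
  ultimately obtain f where "f \<in> O'" "\<And>w. w \<in> W \<Longrightarrow> f \<bullet> w \<noteq> 0"
    using open_avoids_hyperplanes[OF assms, of W "{}"] by blast
  then have "generic f" unfolding generic_def W_def by blast
  with \<open>f \<in> O'\<close> show thesis by (rule that)
qed

lemma card_vertices_le:
  assumes "DIM('a) \<le> card L"
  shows "card vertices \<le> U (card L) (DIM('a) - 1)"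
proof -
  have "card vertices = card vertex_sets"
    unfolding vertex_sets_def using inj_on_zeros by (simp add: card_image)
  also have "\<dots> \<le> U (card L) (DIM('a) - 1)"
  proof -
    obtain f where f: "generic f" using ex_generic[of UNIV] by auto
    then have f': "generic (- f)" by (simp add: generic_def)
    \<comment> \<open>No edge is level for generic \<open>f\<close>, so reversing the objective
      exchanges descents and ascents.\<close>
    have desc': "S - descents f S = descents (- f) S" if "S \<in> vertex_sets" for S
      using f that by (force simp: descents_def generic_def)
    show ?thesis
    proof (rule upper_bound_interval_partition[where r = "descents f"])
      show "S \<subseteq> L \<and> card S = DIM('a) - 1" if "S \<in> vertex_sets" for S
        using that by (auto simp: vertex_sets_def vertices_def zeros_def)
      show "interval_partition vertex_sets (\<lambda>S. S - descents f S)"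
        using interval_partition_descents[OF f'] interval_partition_cong[OF desc'] by simp
      show "\<exists>q. interval_partition vertex_sets q \<and> (\<forall>S\<in>vertex_sets. i \<in> S \<longrightarrow> i \<notin> q S)"
        if "i \<in> L" for i
      proof -
        txt \<open>Objectives near \<open>i\<close> are minimal on the facet of \<open>i\<close>, so every edge leaving that facet ascends.\<close>
        define O' where "O' = (\<Inter>S\<in>{S \<in> vertex_sets. i \<in> S}. {g. 0 < g \<bullet> edge S i})"
        have "open O'" unfolding O'_def using finite_vertex_sets
          by (intro open_INT) (auto intro!: open_Collect_less continuous_intros)
        moreover have "i \<in> O'" using edge(2) by (auto simp: O'_def vertex_sets_def)
        ultimately obtain g where g: "g \<in> O'" "generic g" using ex_generic by blast
        then have "i \<notin> descents g S" if "S \<in> vertex_sets" "i \<in> S" for S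
          using that by (auto simp: O'_def descents_def dest!: bspec)
        then show ?thesis using interval_partition_descents[OF g(2)] by blast
      qed
      show "DIM('a) - 1 < card L" using assms DIM_positive[where 'a='a] by linarith
    qed (use finite_vertex_sets finite_L interval_partition_descents[OF f] in auto)
  qed
  finally show ?thesis .
qed

end

section \<open>Dequantisation\<close>

lemma common_convergent_subsequence:
  fixes f :: "'i \<Rightarrow> nat \<Rightarrow> ereal"
  assumes "finite I"
  shows "\<exists>s l. strict_mono (s :: nat \<Rightarrow> nat) \<and> (\<forall>i\<in>I. (\<lambda>n. f i (s n)) \<longlonglongrightarrow> l i)"
  using assms
proof (induction I rule: finite_induct)
  case empty
  show ?case by (intro exI[of _ id]) (auto simp: strict_mono_def)
next
  case (insert i I)
  then obtain s l where s: "strict_mono s" "\<forall>j\<in>I. (\<lambda>n. f j (s n)) \<longlonglongrightarrow> l j" by blast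
  obtain a r where r: "strict_mono r" "((\<lambda>n. f i (s n)) \<circ> r) \<longlonglongrightarrow> a"
    using compact_imp_seq_compact[OF compact_UNIV] unfolding seq_compact_def by blast
  have "(\<lambda>n. f j ((s \<circ> r) n)) \<longlonglongrightarrow> (l(i := a)) j" if "j \<in> insert i I" for j
  proof (cases "j = i")
    case True
    then show ?thesis using r by (simp add: o_def)
  next
    case False
    then have "(\<lambda>n. f j (s n)) \<longlonglongrightarrow> l j" using s that by blast
    then show ?thesis using LIMSEQ_subseq_LIMSEQ[OF _ r(1)] False by (fastforce simp: o_def)
  qed
  moreover have "strict_mono (s \<circ> r)" using s r strict_mono_o by blast
  ultimately show ?case by blast
qed

section \<open>Logarithms and exponentials to base \<open>exp t\<close>\<close>

definition tlog :: "real \<Rightarrow> real \<Rightarrow> ereal"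
  where "tlog t y = (if y \<le> 0 then -\<infinity> else ereal (ln y / t))"

definition texp :: "real \<Rightarrow> ereal \<Rightarrow> real"
  where "texp t a = (if a = -\<infinity> then 0 else exp (t * real_of_ereal a))"

lemma texp_nonneg: "0 \<le> texp t a"
  by (simp add: texp_def)

lemma texp_add: "a \<noteq> \<infinity> \<Longrightarrow> b \<noteq> \<infinity> \<Longrightarrow> texp t (a + b) = texp t a * texp t b"
  by (cases a; cases b) (simp_all add: texp_def exp_add distrib_left)

lemma texp_mono: "0 \<le> t \<Longrightarrow> a \<le> b \<Longrightarrow> b \<noteq> \<infinity> \<Longrightarrow> texp t a \<le> texp t b"
  by (cases a; cases b) (simp_all add: texp_def mult_left_mono)

lemma tlog_texp: "0 < t \<Longrightarrow> a \<noteq> \<infinity> \<Longrightarrow> tlog t (texp t a) = a"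
  by (cases a) (simp_all add: texp_def tlog_def)

lemma tlog_mult: "0 \<le> x \<Longrightarrow> 0 \<le> y \<Longrightarrow> tlog t (x * y) = tlog t x + tlog t y"
  by (auto simp: tlog_def ln_mult add_divide_distrib mult_le_0_iff)

lemma tlog_mono: "0 < t \<Longrightarrow> x \<le> y \<Longrightarrow> tlog t x \<le> tlog t y"
  by (auto simp: tlog_def intro!: divide_right_mono)

lemma tendsto_tlog_const:
  assumes t: "filterlim t at_top F" and c: "0 < c"
  shows "((\<lambda>n. tlog (t n) c) \<longlongrightarrow> 0) F"
proof -
  have "((\<lambda>n. ln c / t n) \<longlongrightarrow> 0) F"
    by (rule tendsto_divide_0[OF tendsto_const filterlim_at_top_imp_at_infinity[OF t]])
  then show ?thesis using c by (simp add: tlog_def zero_ereal_def)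
qed

lemma tendsto_ereal_add_not_PInf:
  fixes x y :: ereal
  assumes "x \<noteq> \<infinity>" "y \<noteq> \<infinity>" "(f \<longlongrightarrow> x) F" "(g \<longlongrightarrow> y) F"
  shows "((\<lambda>n. f n + g n) \<longlongrightarrow> x + y) F"
  using assms by (intro tendsto_add_ereal_general) auto

lemma tendsto_Max:
  fixes f :: "'i \<Rightarrow> 'b \<Rightarrow> 'c::linorder_topology"
  assumes "finite K" "K \<noteq> {}" "\<And>k. k \<in> K \<Longrightarrow> (f k \<longlongrightarrow> z k) F"
  shows "((\<lambda>n. MAX k\<in>K. f k n) \<longlongrightarrow> (MAX k\<in>K. z k)) F"
  using assms
proof (induction K rule: finite_ne_induct)
  case (insert k K)
  then show ?case by (simp add: tendsto_max)
qed auto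

text \<open>A sum of nonnegative terms lies between its largest term and \<open>card K\<close> times
  that term. The scaled logarithm of the constant \<open>card K\<close> tends to 0, so sums become
  maxima in the limit.\<close>

lemma tendsto_tlog_sum:
  fixes y :: "'i \<Rightarrow> 'b \<Rightarrow> real"
  assumes t: "filterlim t at_top F" and t0: "\<And>n. 0 < t n"
    and K: "finite K" "K \<noteq> {}" and y: "\<And>k n. k \<in> K \<Longrightarrow> 0 \<le> y k n"
    and lim: "\<And>k. k \<in> K \<Longrightarrow> ((\<lambda>n. tlog (t n) (y k n)) \<longlongrightarrow> z k) F"
    and z: "\<And>k. k \<in> K \<Longrightarrow> z k \<noteq> \<infinity>"
  shows "((\<lambda>n. tlog (t n) (\<Sum>k\<in>K. y k n)) \<longlongrightarrow> (MAX k\<in>K. z k)) F"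
proof (rule tendsto_sandwich)
  let ?m = "\<lambda>n. MAX k\<in>K. tlog (t n) (y k n)"
  have mono_Max: "tlog (t n) (MAX k\<in>K. y k n) = ?m n" for n
    using mono_Max_commute[of "tlog (t n)" "(\<lambda>k. y k n) ` K"] K tlog_mono[OF t0]
    by (simp add: monoI image_image)
  show m: "(?m \<longlongrightarrow> (MAX k\<in>K. z k)) F" using K lim by (rule tendsto_Max)
  show "((\<lambda>n. tlog (t n) (card K) + ?m n) \<longlongrightarrow> (MAX k\<in>K. z k)) F"
  proof -
    have "(MAX k\<in>K. z k) \<in> z ` K" using K by (intro Max_in) auto
    then have "(MAX k\<in>K. z k) \<noteq> \<infinity>" using z by force
    moreover have "((\<lambda>n. tlog (t n) (card K)) \<longlongrightarrow> 0) F"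
      using K by (intro tendsto_tlog_const[OF t]) (simp add: card_gt_0_iff)
    ultimately have "((\<lambda>n. tlog (t n) (card K) + ?m n) \<longlongrightarrow> 0 + (MAX k\<in>K. z k)) F"
      using m by (intro tendsto_ereal_add_not_PInf) auto
    then show ?thesis by simp
  qed
  show "\<forall>\<^sub>F n in F. ?m n \<le> tlog (t n) (\<Sum>k\<in>K. y k n)"
  proof (intro always_eventually allI)
    fix n
    have "y k n \<le> (\<Sum>k\<in>K. y k n)" if "k \<in> K" for k
      using that K y by (intro member_le_sum) auto
    then show "?m n \<le> tlog (t n) (\<Sum>k\<in>K. y k n)"
      using K tlog_mono[OF t0] by simp
  qed
  show "\<forall>\<^sub>F n in F. tlog (t n) (\<Sum>k\<in>K. y k n) \<le> tlog (t n) (card K) + ?m n"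
  proof (intro always_eventually allI)
    fix n
    obtain k where k: "k \<in> K" using K by blast
    have "0 \<le> y k n" using k y by blast
    also have "y k n \<le> (MAX k\<in>K. y k n)" using K k by simp
    finally have nn: "0 \<le> (MAX k\<in>K. y k n)" .
    have "(\<Sum>k\<in>K. y k n) \<le> of_nat (card K) * (MAX k\<in>K. y k n)"
      using K by (intro sum_bounded_above) simp
    then have "tlog (t n) (\<Sum>k\<in>K. y k n) \<le> tlog (t n) (card K * (MAX k\<in>K. y k n))"
      by (rule tlog_mono[OF t0])
    also have "\<dots> = tlog (t n) (card K) + ?m n"
      using nn by (simp only: tlog_mult of_nat_0_le_iff mono_Max)
    finally show "tlog (t n) (\<Sum>k\<in>K. y k n) \<le> tlog (t n) (card K) + ?m n" .
  qed
qed

text \<open>One term is split off at a time: extremality makes \<open>u\<close> equal to it or to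
  the maximum of the rest. Membership of the partial maxima in \<open>C\<close> is carried along,
  since extremality only concerns elements of \<open>C\<close>.\<close>

lemma extreme_generator_Max:
  fixes w :: "'k \<Rightarrow> ereal ^ 'd"
  assumes C: "trop_cone C" and u: "extreme_generator C u"
    and K: "finite K" "K \<noteq> {}" "\<And>k. k \<in> K \<Longrightarrow> w k \<in> C" and eq: "u = (\<chi> j. MAX k\<in>K. w k $ j)"
  shows "\<exists>k\<in>K. u = w k"
proof -
  have add: "trop_add v v' \<in> C" if "v \<in> C" "v' \<in> C" for v v'
  proof -
    have "trop_add (trop_scale 0 v) (trop_scale 0 v') \<in> C"
      using C that by (auto simp: trop_cone_def Rmax_def)
    then show ?thesis by (simp add: trop_scale_def)
  qed
  have "(\<chi> j. MAX k\<in>K. w k $ j) \<in> C \<and> (u = (\<chi> j. MAX k\<in>K. w k $ j) \<longrightarrow> (\<exists>k\<in>K. u = w k))"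
    using K
  proof (induction K rule: finite_ne_induct)
    case (singleton k)
    then show ?case by simp
  next
    case (insert k K)
    have "(\<chi> j. MAX k\<in>insert k K. w k $ j) = trop_add (w k) (\<chi> j. MAX k\<in>K. w k $ j)"
      using insert by (simp add: trop_add_def)
    then show ?case using insert add u unfolding extreme_generator_def by (metis insert_iff)
  qed
  then show ?thesis using eq by blast
qed

lemma trop_ray_scale:
  assumes "\<bar>c\<bar> \<noteq> \<infinity>"
  shows "trop_ray (trop_scale c u) = trop_ray u"
proof -
  obtain r where r: "c = ereal r" using assms by (cases c) auto
  have sub: "trop_ray (trop_scale (ereal s) v) \<subseteq> trop_ray v" for s and v :: "ereal ^ 'a"
    by (auto simp: trop_ray_def trop_scale_def Rmax_def add.assoc[symmetric] intro!: image_eqI)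
  have "u = trop_scale (ereal (- r)) (trop_scale c u)"
    by (simp add: trop_scale_def vec_eq_iff r add.assoc[symmetric] zero_ereal_def[symmetric])
  then have "trop_ray u \<subseteq> trop_ray (trop_scale c u)" using sub by metis
  then show ?thesis using sub[of r u] r by blast
qed

section \<open>Classical cones approximating the tropical cone\<close>

lemma mem_trop_system_cone_iff:
  fixes A B :: "ereal ^ 'd::finite ^ 'p::finite"
  shows "x \<in> trop_system_cone A B \<longleftrightarrow> (\<forall>j. x $ j \<noteq> \<infinity>) \<and>
    (\<forall>i. (MAX j. A $ i $ j + x $ j) \<le> (MAX j. B $ i $ j + x $ j))"
  by (simp add: trop_system_cone_def Rmax_vec_def Rmax_def)

text \<open>Every term on the left is at most a single term
  \<open>texp t (B $ i $ k) * texp t (x $ k)\<close>, as \<open>texp\<close> is monotone and turns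
  sums into products; adding the \<open>CARD('d)\<close> left terms brings in the factor.\<close>

lemma texp_trop_system_cone:
  fixes A B :: "ereal ^ 'd::finite ^ 'p::finite"
  assumes A: "\<And>i j. A $ i $ j \<noteq> \<infinity>" and B: "\<And>i j. B $ i $ j \<noteq> \<infinity>"
    and x: "x \<in> trop_system_cone A B" and t: "0 \<le> t"
  shows "(\<Sum>j\<in>UNIV. texp t (A $ i $ j) * texp t (x $ j)) \<le>
    (\<Sum>j\<in>UNIV. CARD('d) * texp t (B $ i $ j) * texp t (x $ j))"
proof -
  have x': "x $ j \<noteq> \<infinity>" for j using x by (simp add: mem_trop_system_cone_iff)
  let ?S = "\<Sum>j\<in>UNIV. texp t (B $ i $ j) * texp t (x $ j)"
  have le: "texp t (A $ i $ j) * texp t (x $ j) \<le> ?S" for j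
  proof -
    have "A $ i $ j + x $ j \<le> (MAX j. A $ i $ j + x $ j)" by simp
    also have "\<dots> \<le> (MAX j. B $ i $ j + x $ j)" using x by (simp add: mem_trop_system_cone_iff)
    finally have "A $ i $ j + x $ j \<le> (MAX j. B $ i $ j + x $ j)" .
    then obtain k where k: "A $ i $ j + x $ j \<le> B $ i $ k + x $ k"
      by (subst (asm) Max_ge_iff) auto
    have "texp t (A $ i $ j) * texp t (x $ j) = texp t (A $ i $ j + x $ j)"
      using A x' by (simp add: texp_add)
    also have "\<dots> \<le> texp t (B $ i $ k + x $ k)"
      using k B[of i k] x'[of k] t by (intro texp_mono) auto
    also have "\<dots> = texp t (B $ i $ k) * texp t (x $ k)" using B x' by (simp add: texp_add)
    also have "\<dots> \<le> ?S" by (intro member_le_sum) (auto simp: texp_nonneg)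
    finally show ?thesis .
  qed
  have "(\<Sum>j\<in>UNIV. texp t (A $ i $ j) * texp t (x $ j)) \<le> of_nat CARD('d) * ?S"
    using le by (intro sum_bounded_above) auto
  then show ?thesis by (simp add: sum_distrib_left mult.assoc)
qed

lemma inner_One_cart: "One \<bullet> (x :: real ^ 'd) = (\<Sum>j\<in>UNIV. x $ j)"
proof -
  have "(One :: real ^ 'd) $ j = 1" for j
    by (simp add: cart_eq_inner_axis)
  then show ?thesis by (simp add: inner_vec_def)
qed

text \<open>The factor \<open>CARD('d)\<close> makes the exponential of the tropical cone satisfy the classical inequalities
  (a maximum of \<open>d\<close> terms bounds their sum up to \<open>d\<close>), and the slack \<open>\<delta>\<close> leaves room for a perturbation
  into general position. Both disappear in the limit. The generators are indexed by all of \<open>nat\<close>, with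
  repetitions, so that their number does not depend on \<open>t\<close>.\<close>

lemma generators_of_exponential_cone:
  fixes A B :: "ereal ^ 'd::finite ^ 'p::finite"
  defines "N \<equiv> U (CARD('p) + CARD('d)) (CARD('d) - 1)"
  assumes A: "\<And>i j. A $ i $ j \<noteq> \<infinity>" and B: "\<And>i j. B $ i $ j \<noteq> \<infinity>"
    and x0: "x0 \<in> trop_system_cone A B" "x0 \<noteq> (\<chi> j. -\<infinity>)" and t: "0 < t" and \<delta>: "0 < \<delta>"
  shows "0 < N \<and> (\<exists>g :: nat \<Rightarrow> real ^ 'd.
    (\<forall>k j. 0 \<le> g k $ j) \<and> (\<forall>k. (\<Sum>j\<in>UNIV. g k $ j) = 1) \<and>
    (\<forall>k i. (\<Sum>j\<in>UNIV. texp t (A $ i $ j) * g k $ j) \<le>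
       (\<Sum>j\<in>UNIV. (CARD('d) * texp t (B $ i $ j) + \<delta>) * g k $ j)) \<and>
    (\<forall>x\<in>trop_system_cone A B. \<exists>c. (\<forall>k. 0 \<le> c k) \<and>
       (\<forall>j. texp t (x $ j) = (\<Sum>k<N. c k * g k $ j))))"
proof -
  \<comment> \<open>\<open>b i\<close> is the normal of the classical half-space. Any
    \<open>m i\<close> in the box dominates it coordinatewise, so the perturbed half-space keeps the
    exponentials of the tropical cone, yet exceeds it by less than \<open>\<delta>\<close>.\<close>
  define b where "b i = (\<chi> j. CARD('d) * texp t (B $ i $ j) - texp t (A $ i $ j))" for i
  define O' where "O' i = box (b i) (b i + (\<chi> j. \<delta>))" for i
  have "open (O' i)" for i unfolding O'_def by (rule open_box)
  moreover have "b i + (\<chi> j. \<delta> / 2) \<in> O' i" for i using \<delta> by (simp add: O'_def mem_box_cart)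
  then have "O' i \<noteq> {}" for i by blast
  ultimately obtain m where m: "\<And>i. m i \<in> O' i" "general_position (Basis \<union> range m)"
    "card (Basis \<union> range m) = CARD('p) + DIM(real ^ 'd)"
    using general_position_extend[of "UNIV :: 'p set" O'] by auto
  define L where "L = Basis \<union> range m"
  interpret generic_cone L
    by standard (use m in \<open>auto simp: L_def\<close>)
  have cardL: "card L = CARD('p) + CARD('d)" using m(3) by (simp add: L_def)
  have coord: "0 \<le> v $ j" if "v \<in> feasible_cone" for v j
  proof -
    have "axis j 1 \<in> L" by (simp add: L_def axis_in_Basis_iff)
    then have "0 \<le> axis j 1 \<bullet> v" using that by (auto simp: feasible_cone_def)
    then show ?thesis by (simp add: cart_eq_inner_axis inner_commute)
  qed
  have m_less: "b i $ j < m i $ j" "m i $ j < b i $ j + \<delta>" for i j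
    using m(1)[of i] by (auto simp: O'_def mem_box_cart)
  have texp_cone: "(\<chi> j. texp t (x $ j)) \<in> feasible_cone" if x: "x \<in> trop_system_cone A B" for x
    unfolding feasible_cone_def mem_Collect_eq
  proof
    fix l assume "l \<in> L"
    then consider j where "l = axis j 1" | i where "l = m i" by (auto simp: L_def Basis_vec_def)
    then show "0 \<le> l \<bullet> (\<chi> j. texp t (x $ j))"
    proof cases
      case 1
      then have "l \<bullet> (\<chi> j. texp t (x $ j)) = (\<chi> j. texp t (x $ j)) $ j"
        by (metis cart_eq_inner_axis inner_commute)
      then show ?thesis by (simp add: texp_nonneg)
    next
      case 2
      have "0 \<le> (\<Sum>j\<in>UNIV. CARD('d) * texp t (B $ i $ j) * texp t (x $ j)) -
          (\<Sum>j\<in>UNIV. texp t (A $ i $ j) * texp t (x $ j))"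
        using texp_trop_system_cone[OF A B x, of t i] t by simp
      also have "\<dots> = (\<Sum>j\<in>UNIV. b i $ j * texp t (x $ j))"
        by (simp add: b_def sum_subtractf left_diff_distrib)
      also have "\<dots> \<le> (\<Sum>j\<in>UNIV. m i $ j * texp t (x $ j))"
        using m_less by (intro sum_mono mult_right_mono) (auto simp: texp_nonneg less_imp_le)
      finally show ?thesis using 2 by (simp add: inner_vec_def)
    qed
  qed
  define M where "M = card vertices"
  obtain h where h: "bij_betw h {0..<M} vertices"
    using ex_bij_betw_nat_finite[OF finite_vertices] by (auto simp: M_def)
  have "M \<le> N" using card_vertices_le by (simp add: M_def N_def cardL)
  \<comment> \<open>Without vertices the cone would be 0, but it contains the nonzero exponential of
    \<open>x0\<close>.\<close>
  have "vertices \<noteq> {}"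
  proof
    assume "vertices = {}"
    then have "(\<chi> j. texp t (x0 $ j)) = 0" using cone_generated[OF texp_cone[OF x0(1)]] by auto
    then have "texp t (x0 $ j) = 0" for j by (simp add: vec_eq_iff)
    then have "x0 $ j = -\<infinity>" for j by (metis exp_not_eq_zero texp_def)
    then show False using x0(2) by (simp add: vec_eq_iff)
  qed
  then have "0 < M" using finite_vertices by (simp add: M_def card_gt_0_iff)
  define g where "g k = h (if k < M then k else 0)" for k
  have g: "g k \<in> vertices" for k
    using h \<open>0 < M\<close> by (auto simp: g_def bij_betw_def)
  then have gc: "g k \<in> feasible_cone" "One \<bullet> g k = 1" for k by (auto simp: vertices_def)
  show ?thesis
  proof (intro conjI exI[of _ g] allI ballI)
    show "0 < N" using \<open>0 < M\<close> \<open>M \<le> N\<close> by simp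
    show nn: "0 \<le> g k $ j" for k j using gc coord by blast
    show "(\<Sum>j\<in>UNIV. g k $ j) = 1" for k using gc by (simp add: inner_One_cart)
    show "(\<Sum>j\<in>UNIV. texp t (A $ i $ j) * g k $ j) \<le>
       (\<Sum>j\<in>UNIV. (CARD('d) * texp t (B $ i $ j) + \<delta>) * g k $ j)" for k i
    proof -
      have "m i \<in> L" by (simp add: L_def)
      then have "0 \<le> m i \<bullet> g k" using gc by (auto simp: feasible_cone_def)
      also have "\<dots> = (\<Sum>j\<in>UNIV. m i $ j * g k $ j)" by (simp add: inner_vec_def)
      also have "\<dots> \<le> (\<Sum>j\<in>UNIV. (b i $ j + \<delta>) * g k $ j)"
        using m_less nn by (intro sum_mono mult_right_mono) (auto simp: less_imp_le)
      also have "\<dots> = (\<Sum>j\<in>UNIV. (CARD('d) * texp t (B $ i $ j) + \<delta>) * g k $ j) -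
          (\<Sum>j\<in>UNIV. texp t (A $ i $ j) * g k $ j)"
        by (simp add: b_def flip: sum_subtractf) (simp add: algebra_simps)
      finally show ?thesis by simp
    qed
    show "\<exists>c. (\<forall>k. 0 \<le> c k) \<and> (\<forall>j. texp t (x $ j) = (\<Sum>k<N. c k * g k $ j))"
      if x: "x \<in> trop_system_cone A B" for x
    proof -
      obtain c where c: "\<forall>v\<in>vertices. 0 \<le> c v" "(\<chi> j. texp t (x $ j)) = (\<Sum>v\<in>vertices. c v *\<^sub>R v)"
        using cone_generated[OF texp_cone[OF x]] by blast
      \<comment> \<open>Indices from \<open>M\<close> on repeat the vertex \<open>h 0\<close>;
        coefficient 0 there makes each vertex count once.\<close>
      have "texp t (x $ j) = (\<Sum>k<N. (if k < M then c (g k) else 0) * g k $ j)" for j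
      proof -
        have "texp t (x $ j) = (\<Sum>v\<in>vertices. c v * v $ j)"
          using arg_cong[OF c(2), of "\<lambda>v. v $ j"] by simp
        also have "\<dots> = (\<Sum>k\<in>{0..<M}. c (h k) * h k $ j)"
          using h by (rule sum.reindex_bij_betw[symmetric])
        also have "\<dots> = (\<Sum>k<N. (if k < M then c (g k) else 0) * g k $ j)"
          using \<open>M \<le> N\<close> by (intro sum.mono_neutral_cong_left) (auto simp: g_def)
        finally show ?thesis .
      qed
      then show ?thesis
        using c(1) g by (intro exI[of _ "\<lambda>k. if k < M then c (g k) else 0"]) auto
    qed
  qed
qed

section \<open>Passage to the limit\<close>

text \<open>The logarithms of the generators converge along a common subsequence to
  \<open>V\<close>. By \<open>tendsto_tlog_sum\<close>, inequalities and nonnegative combinations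
  become max-plus ones.\<close>

lemma trop_system_cone_finitely_generated:
  fixes A B :: "ereal ^ 'd::finite ^ 'p::finite"
  defines "N \<equiv> U (CARD('p) + CARD('d)) (CARD('d) - 1)"
  assumes A: "\<And>i j. A $ i $ j \<noteq> \<infinity>" and B: "\<And>i j. B $ i $ j \<noteq> \<infinity>"
    and x0: "x0 \<in> trop_system_cone A B" "x0 \<noteq> (\<chi> j. -\<infinity>)"
  shows "0 < N \<and> (\<exists>V. (\<forall>k<N. V k \<in> trop_system_cone A B) \<and>
    (\<forall>x\<in>trop_system_cone A B. \<exists>\<mu>. (\<forall>k<N. \<mu> k \<noteq> \<infinity>) \<and>
      x = (\<chi> j. MAX k\<in>{..<N}. \<mu> k + V k $ j)))"
proof -
  let ?C = "trop_system_cone A B"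
  define t where "t n = real (Suc n)" for n
  define \<delta> where "\<delta> n = exp (- (t n * t n))" for n
  \<comment> \<open>quadratic exponent: \<open>tlog (t n) (\<delta> n)\<close> must tend to \<open>-\<infinity>\<close>, as \<open>B\<close> may have infinite entries\<close>
  have tpos: "0 < t n" and \<delta>pos: "0 < \<delta> n" for n by (auto simp: t_def \<delta>_def)
  have N0: "0 < N"
    using generators_of_exponential_cone[OF A B x0 tpos \<delta>pos] by (simp add: N_def)
  define Q where "Q n g \<longleftrightarrow> (\<forall>k j. 0 \<le> g k $ j) \<and> (\<forall>k. (\<Sum>j\<in>UNIV. g k $ j) = 1) \<and>
    (\<forall>k i. (\<Sum>j\<in>UNIV. texp (t n) (A $ i $ j) * g k $ j) \<le>
       (\<Sum>j\<in>UNIV. (CARD('d) * texp (t n) (B $ i $ j) + \<delta> n) * g k $ j)) \<and>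
    (\<forall>x\<in>?C. \<exists>c. (\<forall>k. 0 \<le> c k) \<and> (\<forall>j. texp (t n) (x $ j) = (\<Sum>k<N. c k * g k $ j)))"
    for n and g :: "nat \<Rightarrow> real ^ 'd"
  have "\<exists>g. Q n g" for n
    using generators_of_exponential_cone[OF A B x0 tpos \<delta>pos, of n n] unfolding Q_def N_def by blast
  then obtain g where "\<And>n. Q n (g n)" by metis
  then have g_nonneg: "\<And>n k j. 0 \<le> g n k $ j" and g_sum: "\<And>n k. (\<Sum>j\<in>UNIV. g n k $ j) = 1"
    and g_le: "\<And>n k i. (\<Sum>j\<in>UNIV. texp (t n) (A $ i $ j) * g n k $ j) \<le>
       (\<Sum>j\<in>UNIV. (CARD('d) * texp (t n) (B $ i $ j) + \<delta> n) * g n k $ j)"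
    and g_gen: "\<And>n x. x \<in> ?C \<Longrightarrow> \<exists>c. (\<forall>k. 0 \<le> c k) \<and> (\<forall>j. texp (t n) (x $ j) = (\<Sum>k<N. c k * g n k $ j))"
    unfolding Q_def by blast+
  obtain s l where s: "strict_mono s"
    and l: "\<And>k j. k < N \<Longrightarrow> (\<lambda>n. tlog (t (s n)) (g (s n) k $ j)) \<longlonglongrightarrow> l (k, j)"
    using common_convergent_subsequence[of "{..<N} \<times> UNIV" "\<lambda>(k, j) n. tlog (t n) (g n k $ j)"] by auto
  define V where "V k = (\<chi> j. l (k, j))" for k
  have g_le1: "g n k $ j \<le> 1" for n k j
    using member_le_sum[of j UNIV "\<lambda>j. g n k $ j"] g_nonneg g_sum by auto
  have t_lim: "filterlim (\<lambda>n. t (r n)) at_top sequentially" if "strict_mono r" for r :: "nat \<Rightarrow> nat"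
  proof -
    have "filterlim t at_top sequentially" unfolding t_def
      by (rule filterlim_compose[OF filterlim_real_sequentially filterlim_Suc])
    then show ?thesis using filterlim_compose filterlim_subseq[OF that] by blast
  qed
  \<comment> \<open>The coordinates of a generator sum to 1, so their logarithms are at most 0 and
    the limits stay below \<open>\<infinity>\<close>.\<close>
  have V_fin: "V k $ j \<noteq> \<infinity>" if "k < N" for k j
  proof -
    have "tlog (t (s n)) (g (s n) k $ j) \<le> 0" for n
      using tlog_mono[OF tpos g_le1] by (simp add: tlog_def zero_ereal_def)
    then have "l (k, j) \<le> 0" by (intro LIMSEQ_le_const2[OF l[OF that]]) auto
    then show ?thesis by (auto simp: V_def)
  qed
  have V_lim: "(\<lambda>n. tlog (t (s n)) (a n * g (s n) k $ j)) \<longlonglongrightarrow> z + V k $ j"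
    if "k < N" "\<And>n. 0 \<le> a n" "z \<noteq> \<infinity>" "(\<lambda>n. tlog (t (s n)) (a n)) \<longlonglongrightarrow> z" for k j a z
    using tendsto_ereal_add_not_PInf[OF that(3) V_fin[OF that(1)] that(4), of "\<lambda>n. tlog (t (s n)) (g (s n) k $ j)"]
      l[OF that(1)] that(2) g_nonneg by (simp add: tlog_mult V_def)
  have B_lim: "(\<lambda>n. tlog (t (s n)) (CARD('d) * texp (t (s n)) (B $ i $ j) + \<delta> (s n))) \<longlonglongrightarrow> B $ i $ j" for i j
  proof -
    \<comment> \<open>The two summands are indexed by \<open>bool\<close>; the slack has logarithm
      \<open>- t (s n)\<close> and drops out of the maximum.\<close>
    define y where "y k n = (if k then CARD('d) * texp (t (s n)) (B $ i $ j) else \<delta> (s n))" for k n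
    have "(\<lambda>n. tlog (t (s n)) (CARD('d)) + B $ i $ j) \<longlonglongrightarrow> 0 + B $ i $ j"
      using B by (intro tendsto_ereal_add_not_PInf tendsto_tlog_const t_lim s) auto
    then have 1: "(\<lambda>n. tlog (t (s n)) (y True n)) \<longlonglongrightarrow> B $ i $ j"
      using B tpos by (simp add: y_def tlog_mult texp_nonneg tlog_texp)
    have "tlog (t n) (\<delta> n) = - ereal (t n)" for n
      using tpos[of n] by (simp add: tlog_def \<delta>_def)
    moreover have "(\<lambda>n. - ereal (t (s n))) \<longlonglongrightarrow> - \<infinity>"
      by (rule tendsto_uminus_ereal[OF tendsto_PInfty_eq_at_top[THEN iffD2, OF t_lim[OF s]]])
    ultimately have 2: "(\<lambda>n. tlog (t (s n)) (y False n)) \<longlonglongrightarrow> - \<infinity>"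
      by (simp add: y_def)
    have "(\<lambda>n. tlog (t (s n)) (\<Sum>k\<in>UNIV. y k n)) \<longlonglongrightarrow> (MAX k\<in>UNIV. if k then B $ i $ j else - \<infinity>)"
    proof (rule tendsto_tlog_sum[OF t_lim[OF s] tpos])
      show "0 \<le> y k n" for k n using \<delta>pos by (simp add: y_def texp_nonneg less_imp_le)
      show "(\<lambda>n. tlog (t (s n)) (y k n)) \<longlonglongrightarrow> (if k then B $ i $ j else - \<infinity>)" for k
        using 1 2 by (cases k) auto
    qed (use B in auto)
    then show ?thesis by (simp add: UNIV_bool y_def add.commute)
  qed
  have V_C: "V k \<in> ?C" if k: "k < N" for k
    unfolding mem_trop_system_cone_iff
  proof (intro conjI allI)
    fix i
    show "(MAX j. A $ i $ j + V k $ j) \<le> (MAX j. B $ i $ j + V k $ j)"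
    proof (rule LIMSEQ_le)
      show "(\<lambda>n. tlog (t (s n)) (\<Sum>j\<in>UNIV. texp (t (s n)) (A $ i $ j) * g (s n) k $ j))
          \<longlonglongrightarrow> (MAX j. A $ i $ j + V k $ j)"
        using A V_fin[OF k] g_nonneg tpos
        by (intro tendsto_tlog_sum t_lim s V_lim[OF k]) (auto simp: texp_nonneg tlog_texp)
      show "(\<lambda>n. tlog (t (s n)) (\<Sum>j\<in>UNIV. (CARD('d) * texp (t (s n)) (B $ i $ j) + \<delta> (s n)) * g (s n) k $ j))
          \<longlonglongrightarrow> (MAX j. B $ i $ j + V k $ j)"
        using B V_fin[OF k] g_nonneg tpos \<delta>pos
        by (intro tendsto_tlog_sum t_lim s V_lim[OF k] B_lim)
          (auto simp: texp_nonneg less_imp_le intro!: add_nonneg_nonneg mult_nonneg_nonneg)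
      show "\<exists>n0. \<forall>n\<ge>n0. tlog (t (s n)) (\<Sum>j\<in>UNIV. texp (t (s n)) (A $ i $ j) * g (s n) k $ j) \<le>
          tlog (t (s n)) (\<Sum>j\<in>UNIV. (CARD('d) * texp (t (s n)) (B $ i $ j) + \<delta> (s n)) * g (s n) k $ j)"
        using tlog_mono[OF tpos g_le] by blast
    qed
  qed (rule V_fin[OF k])
  have gen: "\<exists>\<mu>. (\<forall>k<N. \<mu> k \<noteq> \<infinity>) \<and> x = (\<chi> j. MAX k\<in>{..<N}. \<mu> k + V k $ j)" if x: "x \<in> ?C" for x
  proof -
    have x_fin: "x $ j \<noteq> \<infinity>" for j using x by (simp add: mem_trop_system_cone_iff)
    obtain c where "\<forall>n. (\<forall>k. 0 \<le> c n k) \<and> (\<forall>j. texp (t n) (x $ j) = (\<Sum>k<N. c n k * g n k $ j))"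
      using choice[of "\<lambda>n c. (\<forall>k. 0 \<le> c k) \<and> (\<forall>j. texp (t n) (x $ j) = (\<Sum>k<N. c k * g n k $ j))"]
        g_gen[OF x] by blast
    then have c: "\<And>n k. 0 \<le> c n k"
      "\<And>n j. texp (t n) (x $ j) = (\<Sum>k<N. c n k * g n k $ j)"
      by blast+
    \<comment> \<open>The coefficients depend on \<open>x\<close>, so this further subsequence does
      too; \<open>V\<close> is unaffected, being a limit along all of \<open>s\<close>.\<close>
    obtain r \<mu> where r: "strict_mono r"
      and \<mu>: "\<And>k. k < N \<Longrightarrow> (\<lambda>n. tlog (t (s (r n))) (c (s (r n)) k)) \<longlonglongrightarrow> \<mu> k"
      using common_convergent_subsequence[of "{..<N}" "\<lambda>k n. tlog (t (s n)) (c (s n) k)"] by auto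
    define q where "q n = s (r n)" for n
    have q: "strict_mono q" using s r by (simp add: q_def strict_mono_def)
    \<comment> \<open>Summing the identity for \<open>x\<close> over \<open>j\<close> removes the
      generators, whose coordinates sum to 1. The resulting bound keeps \<open>\<mu> k\<close> away
      from \<open>\<infinity>\<close>.\<close>
    have c_le: "c n k \<le> (\<Sum>j\<in>UNIV. texp (t n) (x $ j))" if "k < N" for n k
    proof -
      have "c n k \<le> (\<Sum>k<N. c n k)" using that c by (intro member_le_sum) auto
      also have "\<dots> = (\<Sum>k<N. \<Sum>j\<in>UNIV. c n k * g n k $ j)"
        by (simp add: g_sum flip: sum_distrib_left)
      also have "\<dots> = (\<Sum>j\<in>UNIV. texp (t n) (x $ j))"
        unfolding c(2) by (rule sum.swap)
      finally show ?thesis .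
    qed
    have "(\<lambda>n. tlog (t (q n)) (\<Sum>j\<in>UNIV. texp (t (q n)) (x $ j))) \<longlonglongrightarrow> (MAX j. x $ j)"
      using x_fin tpos by (intro tendsto_tlog_sum t_lim q) (auto simp: texp_nonneg tlog_texp)
    then have "\<mu> k \<le> (MAX j. x $ j)" if "k < N" for k
      using \<mu>[OF that] tlog_mono[OF tpos c_le[OF that]] unfolding q_def by (intro LIMSEQ_le) auto
    moreover have "(MAX j. x $ j) \<noteq> \<infinity>"
      using Max_in[of "range (\<lambda>j. x $ j)"] x_fin by fastforce
    ultimately have \<mu>_fin: "\<mu> k \<noteq> \<infinity>" if "k < N" for k using that by fastforce
    have "x $ j = (MAX k\<in>{..<N}. \<mu> k + V k $ j)" for j
    proof (rule LIMSEQ_unique)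
      show "(\<lambda>n. tlog (t (q n)) (texp (t (q n)) (x $ j))) \<longlonglongrightarrow> x $ j"
        using x_fin tpos by (simp add: tlog_texp)
      have "(\<lambda>n. tlog (t (q n)) (c (q n) k * g (q n) k $ j)) \<longlonglongrightarrow> \<mu> k + V k $ j" if "k < N" for k
      proof -
        have "(\<lambda>n. tlog (t (q n)) (g (q n) k $ j)) \<longlonglongrightarrow> V k $ j"
          using LIMSEQ_subseq_LIMSEQ[OF l[OF that] r] by (simp add: V_def q_def o_def)
        then have "(\<lambda>n. tlog (t (q n)) (c (q n) k) + tlog (t (q n)) (g (q n) k $ j)) \<longlonglongrightarrow> \<mu> k + V k $ j"
          using \<mu>[OF that] \<mu>_fin[OF that] V_fin[OF that] unfolding q_def
          by (intro tendsto_ereal_add_not_PInf)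
        then show ?thesis using c g_nonneg by (simp add: tlog_mult)
      qed
      then show "(\<lambda>n. tlog (t (q n)) (texp (t (q n)) (x $ j))) \<longlonglongrightarrow> (MAX k\<in>{..<N}. \<mu> k + V k $ j)"
        unfolding c(2) using N0 \<mu>_fin V_fin c g_nonneg
        by (intro tendsto_tlog_sum t_lim q tpos) auto
    qed
    then show ?thesis using \<mu>_fin by (intro exI[of _ \<mu>]) (simp add: vec_eq_iff)
  qed
  show ?thesis using N0 V_C gen by blast
qed

section \<open>Counting the extreme rays\<close>

theorem theorem1:
  fixes A B :: "ereal ^ 'd::finite ^ 'p::finite"
  assumes "\<And>i j. A $ i $ j \<in> Rmax"
    and "\<And>i j. B $ i $ j \<in> Rmax"
  shows "finite (extreme_rays (trop_system_cone A B)) \<and>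
    card (extreme_rays (trop_system_cone A B)) \<le> U (CARD('p) + CARD('d)) (CARD('d) - 1)"
proof (cases "extreme_rays (trop_system_cone A B) = {}")
  case True
  then show ?thesis by simp
next
  case False
  let ?C = "trop_system_cone A B"
  let ?N = "U (CARD('p) + CARD('d)) (CARD('d) - 1)"
  have AB: "A $ i $ j \<noteq> \<infinity>" "B $ i $ j \<noteq> \<infinity>" for i j using assms by (auto simp: Rmax_def)
  obtain x0 where "x0 \<in> ?C" "x0 \<noteq> (\<chi> j. -\<infinity>)"
    using False by (auto simp: extreme_rays_def extreme_generator_def)
  from trop_system_cone_finitely_generated[OF AB this] obtain V where N0: "0 < ?N"
    and V: "\<And>k. k < ?N \<Longrightarrow> V k \<in> ?C"
    and gen: "\<And>x. x \<in> ?C \<Longrightarrow> \<exists>\<mu>. (\<forall>k<?N. \<mu> k \<noteq> \<infinity>) \<and> x = (\<chi> j. MAX k\<in>{..<?N}. \<mu> k + V k $ j)"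
    by blast
  have cone: "trop_cone ?C" by (rule trop_cone_trop_system_cone)
  have "extreme_rays ?C \<subseteq> (\<lambda>k. trop_ray (V k)) ` {..<?N}"
  proof
    fix Y assume "Y \<in> extreme_rays ?C"
    then obtain x where Y: "Y = trop_ray x" and x: "extreme_generator ?C x" by (auto simp: extreme_rays_def)
    then have xC: "x \<in> ?C" "x \<noteq> (\<chi> j. -\<infinity>)" by (auto simp: extreme_generator_def)
    then obtain \<mu> where \<mu>: "\<And>k. k < ?N \<Longrightarrow> \<mu> k \<noteq> \<infinity>" and eq: "x = (\<chi> j. MAX k\<in>{..<?N}. \<mu> k + V k $ j)"
      using gen by blast
    have "trop_scale (\<mu> k) (V k) \<in> ?C" if "k < ?N" for k
    proof -
      have "trop_add (trop_scale (\<mu> k) (V k)) (trop_scale (\<mu> k) (V k)) \<in> ?C"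
        using cone V[OF that] \<mu>[OF that] unfolding trop_cone_def Rmax_def by blast
      then show ?thesis by (simp add: trop_add_def)
    qed
    moreover have "x = (\<chi> j. MAX k\<in>{..<?N}. trop_scale (\<mu> k) (V k) $ j)"
      using eq by (simp add: trop_scale_def)
    ultimately have "\<exists>k\<in>{..<?N}. x = trop_scale (\<mu> k) (V k)"
      using N0 by (intro extreme_generator_Max[OF cone x]) auto
    then obtain k where k: "k < ?N" "x = trop_scale (\<mu> k) (V k)" by blast
    have "V k $ j \<noteq> \<infinity>" for j using V[OF k(1)] by (simp add: mem_trop_system_cone_iff)
    \<comment> \<open>\<open>V k\<close> scaled by \<open>-\<infinity>\<close> would be the excluded
      all-\<open>-\<infinity>\<close> vector; a finite scalar is invertible, so the rays
      agree.\<close>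
    then have "\<mu> k \<noteq> -\<infinity>" using xC(2) k(2) by (auto simp: trop_scale_def)
    then have "\<bar>\<mu> k\<bar> \<noteq> \<infinity>" using \<mu>[OF k(1)] by auto
    then have "Y = trop_ray (V k)" by (simp add: Y k(2) trop_ray_scale)
    then show "Y \<in> (\<lambda>k. trop_ray (V k)) ` {..<?N}" using k(1) by blast
  qed
  then show ?thesis
    using surj_card_le[of "{..<?N}"] finite_subset[OF _ finite_imageI[of "{..<?N}"]]
    by (metis card_lessThan finite_lessThan)
qed

end
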